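(* (Case (rlv3).) Let $H(x,y)=x^2(2-x^2)+\frac12(1+x)^2y^2$ and, for $h\in(0,1)$, let $\gamma_h$ be the oval surrounding the origin inside the level curve $\{H(x,y)=h\}$, in the period annulus of the origin whose projection on the $x$-axis is $(-1,1)$. For $i=0,1,2$ define $I_i(h)=\int_{\gamma_h}f_i(x)\,y^3\,dx$ with $$f_0(x)=\frac{(5x^4-2x^3-9x^2+4x+8)(x+1)}{2(x-1)^4},\quad f_1(x)=\frac{(7x^4-13x^2+8)(x+1)}{(x-1)^2},\quad f_2(x)=\frac{6x^4+x^3-11x^2-2x+8}{(x-1)^2}.$$ Then $\{I_0,I_1,I_2\}$ is an ECT-system on $(0,1)$.
   Context: The origin is a local minimum of $H$, and the period annulus is the punctured neighbourhood of the origin foliated by the closed curves (ovals) $\gamma_h\subset\{H=h\}$ surrounding the origin. An ordered tuple $(f_0,\ldots,f_{n-1})$ of analytic functions on an open interval $L$ is an extended complete Chebyshev system (ECT-system) on $L$ if, for all $k=1,\ldots,n$, any nontrivial linear combination $\alpha_0f_0+\cdots+\alpha_{k-1}f_{k-1}$ (which is understood not to vanish identically) has at most $k-1$ isolated zeros on $L$ counted with multiplicities; equivalently, the Wronskian $\det(f_j^{(i)}(x))_{0\le i,j\le k-1}\neq0$ for all $k=1,\ldots,n$ and all $x\in L$. A set $\{f_0,\ldots,f_{n-1}\}$ is called an ECT-system on $L$ if its elements form an ECT-system on $L$ when taken in some order. *)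

theory Defs
  imports "HOL-Complex_Analysis.Complex_Analysis" "HOL-Library.Multiset"
begin

definition real_analytic_on :: "(real \<Rightarrow> real) \<Rightarrow> real set \<Rightarrow> bool" where
  "real_analytic_on f L \<longleftrightarrow>
     (\<forall>x\<in>L. \<exists>a r. 0 < r \<and> (\<forall>y. \<bar>y - x\<bar> < r \<longrightarrow> (\<lambda>n. a n * (y - x) ^ n) sums f y))"

definition zero_multiplicity :: "(real \<Rightarrow> real) \<Rightarrow> real \<Rightarrow> nat" where
  "zero_multiplicity f x = (LEAST m. (deriv ^^ m) f x \<noteq> 0)"

text \<open>
  In the following definition a nontrivial linear combination is required not to vanish
  identically, as the usual convention (and the equivalence with nonvanishing Wronskians) demands.
  Since the functions are analytic on an interval, all its zeros are then isolated and of finite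
  multiplicity.
\<close>

definition ECT_system :: "(real \<Rightarrow> real) list \<Rightarrow> real set \<Rightarrow> bool" where
  "ECT_system fs L \<longleftrightarrow>
     open L \<and> is_interval L \<and>
     (\<forall>f\<in>set fs. real_analytic_on f L) \<and>
     (\<forall>k\<in>{1..length fs}. \<forall>\<alpha> :: nat \<Rightarrow> real. (\<exists>j<k. \<alpha> j \<noteq> 0) \<longrightarrow>
        (let F = (\<lambda>x. \<Sum>j<k. \<alpha> j * (fs ! j) x); Z = {x\<in>L. F x = 0}
         in (\<exists>x\<in>L. F x \<noteq> 0) \<and> finite Z \<and> (\<Sum>x\<in>Z. zero_multiplicity F x) \<le> k - 1))"

text \<open>
  A multiset is used instead of a set so that the elements keep their
  multiplicity: a family with a repeated function is never an ECT-system.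
\<close>

definition ECT_set :: "(real \<Rightarrow> real) multiset \<Rightarrow> real set \<Rightarrow> bool" where
  "ECT_set A L \<longleftrightarrow> (\<exists>fs. mset fs = A \<and> ECT_system fs L)"

definition H :: "real \<Rightarrow> real \<Rightarrow> real" where
  "H x y = x\<^sup>2 * (2 - x\<^sup>2) + 1 / 2 * (1 + x)\<^sup>2 * y\<^sup>2"

text \<open>
  The plane is identified with the complex numbers, \<open>z = x + \<i> y\<close>.  The predicate says that \<open>g\<close> is a
  piecewise continuously differentiable parametrization, of either orientation, of the oval
  \<open>\<gamma>\<^sub>h\<close> of the level curve \<open>{H = h}\<close>.
\<close>

definition parametrizes_oval :: "(real \<Rightarrow> complex) \<Rightarrow> real \<Rightarrow> bool" where
  "parametrizes_oval g h \<longleftrightarrow>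
     valid_path g \<and> simple_path g \<and> pathfinish g = pathstart g \<and>
     path_image g \<subseteq> {z. H (Re z) (Im z) = h \<and> Re z \<in> {-1<..<1}} \<and>
     0 \<in> inside (path_image g)"

definition line_integral_dx :: "(real \<Rightarrow> complex) \<Rightarrow> (real \<Rightarrow> real \<Rightarrow> real) \<Rightarrow> real" where
  "line_integral_dx g P =
     integral {0..1} (\<lambda>t. P (Re (g t)) (Im (g t)) * Re (vector_derivative g (at t within {0..1})))"

definition f\<^sub>0 :: "real \<Rightarrow> real" where
  "f\<^sub>0 x = (5 * x ^ 4 - 2 * x ^ 3 - 9 * x\<^sup>2 + 4 * x + 8) * (x + 1) / (2 * (x - 1) ^ 4)"

definition f\<^sub>1 :: "real \<Rightarrow> real" where
  "f\<^sub>1 x = (7 * x ^ 4 - 13 * x\<^sup>2 + 8) * (x + 1) / (x - 1)\<^sup>2"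

definition f\<^sub>2 :: "real \<Rightarrow> real" where
  "f\<^sub>2 x = (6 * x ^ 4 + x ^ 3 - 11 * x\<^sup>2 - 2 * x + 8) / (x - 1)\<^sup>2"

end

theory Submission
  imports Defs
begin

text \<open>
  Put \<open>w = 1 - x\<^sup>2\<close>.  Since \<open>1 - x\<^sup>2 (2 - x\<^sup>2) = w\<^sup>2\<close>, the map
  \<open>(x, y) \<mapsto> (x \<surd>(2 - x\<^sup>2), (1 + x) y / \<surd>2)\<close> carries the oval at level \<open>h\<close> to the circle of radius
  \<open>\<surd>h\<close>; with the polar angle \<open>\<theta>\<close> of the image, \<open>w = \<surd>(1 - h cos\<^sup>2 \<theta>)\<close> on the oval.  The function
  \<open>f\<^sub>i(x) / (1 + x)\<^sup>3\<close> splits as \<open>e\<^sub>i(w) + x d\<^sub>i(w)\<close>, the odd part is a form with a primitive in \<open>sin \<theta>\<close>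
  and so integrates to \<open>0\<close>, and the even part gives (\<open>oval_line_integral\<close>)
  \<open>I\<^sub>i(h) = const \<cdot> h\<^sup>2 \<integral> K\<^sub>i(h cos\<^sup>2 \<theta>) sin\<^sup>4 \<theta> d\<theta>\<close> over a period, where
  \<open>K\<^sub>i(u) = \<surd>(1 + w) e\<^sub>i(w) / w\<close> at \<open>w = \<surd>(1 - u)\<close>.  The constant is \<open>\<plusminus>\<surd>2\<close>, the sign being the
  orientation of the oval, the same for all \<open>h\<close>.

  This formula extends \<open>I\<^sub>i\<close> holomorphically to the unit disc, and an integration by parts
  (\<open>circle_moment_has_derivative\<close>) shows that, up to a nonzero factor, each derivative in \<open>h\<close> lowers by one the powers of \<open>h\<close> and of
  \<open>sin\<^sup>2 \<theta>\<close>.  The integrals are now taken in the order \<open>I\<^sub>1, I\<^sub>2, I\<^sub>0\<close>.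
  If a combination \<open>\<Sum>\<alpha>\<^sub>j I\<^sub>j\<close> of the first \<open>k \<le> 3\<close> of them vanishes to order \<open>k\<close> at a level \<open>h\<close>, then \<open>\<kappa> = \<Sum>\<alpha>\<^sub>j K\<^sub>j\<close>, read as a function of \<open>\<sigma> = sin\<^sup>2 \<theta>\<close>, is orthogonal on the circle to
  \<open>\<sigma>\<^bsup>3-k\<^esup>, \<dots>, \<sigma>\<^sup>2\<close>.  But \<open>\<kappa>\<close> has fewer than \<open>k\<close> zeros in \<open>(0, 1)\<close> unless all \<open>\<alpha>\<^sub>j\<close> are \<open>0\<close>
  (\<open>even_part_few_zeros\<close>), so some polynomial in \<open>\<sigma>\<close> of degree less than \<open>k\<close> has exactly its sign changes,
  and its product with \<open>\<sigma>\<^bsup>3-k\<^esup> \<kappa>\<close> has a nonzero integral (\<open>nonzero_moment\<close>): a contradiction.  The bound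
  on the zeros of \<open>\<kappa>\<close> is a polynomial fact: the determinant of the values of the \<open>w\<^sup>4 e\<^sub>i(w)\<close> at three points
  is the Vandermonde determinant times a symmetric polynomial which is positive for positive arguments.

  So no nontrivial combination of the first \<open>k\<close> integrals vanishes to order \<open>k\<close> anywhere, that is, the
  Wronskians do not vanish.  That this bounds the number of zeros with multiplicity is the classical argument
  of dividing by the first function, differentiating and using Rolle's theorem (\<open>zero_count\<close>).
\<close>

section \<open>Zeros counted with multiplicity\<close>

text \<open>
  Multiplicities are handled through holomorphic extensions, because quotients of holomorphic functions are
  again differentiable to all orders.
\<close>
definition vanishes_to :: "nat \<Rightarrow> (complex \<Rightarrow> complex) \<Rightarrow> complex \<Rightarrow> bool" where
  "vanishes_to m F z \<longleftrightarrow> (\<forall>i<m. (deriv ^^ i) F z = 0)"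

lemma vanishes_to_Suc:
  "vanishes_to (Suc m) F z \<longleftrightarrow> F z = 0 \<and> vanishes_to m (deriv F) z"
  unfolding vanishes_to_def less_Suc_eq_0_disj
  by (auto simp: funpow_swap1[symmetric])

lemma vanishes_to_cong:
  assumes "eventually (\<lambda>w. F w = G w) (nhds z)"
  shows "vanishes_to m F z = vanishes_to m G z"
  using higher_deriv_cong_ev[OF assms refl] by (simp add: vanishes_to_def)

lemma vanishes_to_mult:
  assumes "F holomorphic_on U" "G holomorphic_on U" "open U" "z \<in> U" "vanishes_to m F z"
  shows "vanishes_to m (\<lambda>w. F w * G w) z"
proof -
  have "(deriv ^^ i) (\<lambda>w. F w * G w) z = 0" if "i < m" for i
    using that assms(5)
    by (subst higher_deriv_mult[OF assms(1-4)]) (auto simp: vanishes_to_def)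
  then show ?thesis by (simp add: vanishes_to_def)
qed

text \<open>
  The last conjunct keeps the points found so far to the left of a new largest zero in the induction.
\<close>
lemma rolle_points:
  fixes f f' :: "real \<Rightarrow> real"
  assumes "is_interval L" "finite Z" "Z \<noteq> {}" "Z \<subseteq> L" "\<And>x. x \<in> Z \<Longrightarrow> f x = 0"
    and der: "\<And>x. x \<in> L \<Longrightarrow> (f has_real_derivative f' x) (at x)"
  shows "\<exists>Y. finite Y \<and> Y \<subseteq> L \<and> Y \<inter> Z = {} \<and> Suc (card Y) = card Z \<and> (\<forall>y\<in>Y. f' y = 0)
    \<and> (\<forall>y\<in>Y. \<exists>z\<in>Z. y < z)"
  using assms(2-5)
proof (induction Z rule: finite_linorder_max_induct)
  case empty then show ?case by simp
next
  case (insert b A)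
  show ?case
  proof (cases "A = {}")
    case True then show ?thesis by (intro exI[of _ "{}"]) auto
  next
    case False
    then obtain Y where Y: "finite Y" "Y \<subseteq> L" "Y \<inter> A = {}" "Suc (card Y) = card A"
      "\<forall>y\<in>Y. f' y = 0" "\<forall>y\<in>Y. \<exists>z\<in>A. y < z" using insert by auto
    define a where "a = Max A"
    have a: "a \<in> A" "\<And>x. x \<in> A \<Longrightarrow> x \<le> a" using False insert.hyps by (auto simp: a_def)
    have "a < b" using a insert.hyps by auto
    have ab: "{a..b} \<subseteq> L" 
    proof
      fix x assume "x \<in> {a..b}"
      moreover have "a \<in> L" "b \<in> L" using a insert.prems by auto
      ultimately show "x \<in> L" using assms(1) unfolding is_interval_1 by (meson atLeastAtMost_iff)
    qed
    have "\<exists>z. a < z \<and> z < b \<and> f' z = 0"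
    proof -
      have der': "(f has_real_derivative f' x) (at x)" if "a \<le> x" "x \<le> b" for x
        using der ab that by (meson atLeastAtMost_iff subsetD)
      have "continuous_on {a..b} f"
        using der' by (meson DERIV_atLeastAtMost_imp_continuous_on)
      moreover have "f a = f b" using insert.prems a by auto
      ultimately obtain z where "a < z" "z < b" "(\<lambda>v. f' z * v) = (\<lambda>v. 0)"
        using Rolle_deriv[OF \<open>a < b\<close>, of f "\<lambda>x v. f' x * v"] der'
        unfolding has_field_derivative_def by (metis less_imp_le)
      then show ?thesis by (metis mult.right_neutral)
    qed
    then obtain z where z: "a < z" "z < b" "f' z = 0" by blast
    have zY: "z \<notin> Y" "z \<notin> A" using Y z a by force+
    have "b \<notin> Y" using Y(6) insert.hyps by force
    have "b \<notin> A" using insert.hyps by auto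
    have "z \<in> L" using ab z by auto
    have "Suc (card (insert z Y)) = card (insert b A)"
      using Y zY \<open>b \<notin> A\<close> insert.hyps(1) by simp
    moreover have "insert z Y \<inter> insert b A = {}" using Y(3) zY \<open>b \<notin> Y\<close> z(2) by auto
    ultimately show ?thesis
      using Y(1,2,5,6) z \<open>z \<in> L\<close> by (intro exI[of _ "insert z Y"]) auto
  qed
qed

text \<open>
  Differentiating along the real axis can be done on either side of the extension; in particular the
  derivative of a function that is real on \<open>L\<close> is again real there.
\<close>
lemma real_restriction_deriv:
  assumes "open U" "T holomorphic_on U" "of_real ` L \<subseteq> U" "open L"
    and t: "\<And>x. x \<in> L \<Longrightarrow> of_real (t x) = T (of_real x)" and x: "x \<in> L"
  shows "(t has_real_derivative deriv t x) (at x)"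
    and "of_real (deriv t x) = deriv T (of_real x)"
proof -
  define d where "d = deriv T (of_real x)"
  have "(T has_field_derivative d) (at (of_real x))"
    using assms unfolding d_def by (intro holomorphic_derivI) auto
  then have "((\<lambda>x. T (of_real x)) has_vector_derivative d) (at x)"
    using has_vector_derivative_real_field[of T d x UNIV] by (simp add: o_def)
  then have v: "((\<lambda>x. complex_of_real (t x)) has_vector_derivative d) (at x)"
    using has_vector_derivative_transform_within_open[OF _ \<open>open L\<close> x] t by (metis (no_types, lifting))
  have re: "(t has_real_derivative Re d) (at x)"
    using bounded_linear.has_vector_derivative[OF bounded_linear_Re v]
    by (simp add: has_real_derivative_iff_has_vector_derivative)
  have "((\<lambda>x. 0::real) has_vector_derivative Im d) (at x)"
    using bounded_linear.has_vector_derivative[OF bounded_linear_Im v] by simp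
  then have "Im d = 0"
    by (metis has_vector_derivative_const vector_derivative_unique_at)
  then show "(t has_real_derivative deriv t x) (at x)" "of_real (deriv t x) = deriv T (of_real x)"
    using re DERIV_imp_deriv[OF re] by (auto simp: d_def complex_eq_iff)
qed

lemma real_restriction_higher_deriv:
  assumes "open U" "T holomorphic_on U" "of_real ` L \<subseteq> U" "open L"
    and t: "\<And>x. x \<in> L \<Longrightarrow> of_real (t x) = T (of_real x)" and x: "x \<in> L"
  shows "of_real ((deriv ^^ m) t x) = (deriv ^^ m) T (of_real x)"
  using x
proof (induction m arbitrary: x)
  case 0 then show ?case using t by simp
next
  case (Suc m)
  have "of_real (deriv ((deriv ^^ m) t) x) = deriv ((deriv ^^ m) T) (of_real x)"
    by (rule real_restriction_deriv(2)[OF assms(1) _ assms(3,4) _ Suc.prems])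
       (simp_all add: holomorphic_higher_deriv assms Suc.IH)
  then show ?case by simp
qed

text \<open>
  A zero of multiplicity \<open>m\<close> leaves one of multiplicity \<open>m - 1\<close> of the derivative, and each gap between two
  distinct zeros contributes one more, so only one zero is lost in total.
\<close>
lemma rolle_multiplicities:
  fixes L :: "real set"
  assumes "open U" "T holomorphic_on U" "of_real ` L \<subseteq> U" "open L" "is_interval L"
    and t: "\<And>x. x \<in> L \<Longrightarrow> of_real (t x) = T (of_real x)"
    and Z: "finite Z" "Z \<subseteq> L" "\<And>x. x \<in> Z \<Longrightarrow> vanishes_to (\<mu> x) T (of_real x)"
  obtains Z' \<mu>' where "finite Z'" "Z' \<subseteq> L" "\<And>x. x \<in> Z' \<Longrightarrow> vanishes_to (\<mu>' x) (deriv T) (of_real x)"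
    "sum \<mu> Z \<le> Suc (sum \<mu>' Z')"
proof -
  define A where "A = {x\<in>Z. \<mu> x \<noteq> 0}"
  have A: "finite A" "A \<subseteq> L" using Z by (auto simp: A_def)
  have sA: "sum \<mu> Z = sum \<mu> A" unfolding A_def
    by (rule sum.mono_neutral_right) (use Z in auto)
  note dt = real_restriction_deriv[OF assms(1-4) t]
  show ?thesis
  proof (cases "A = {}")
    case True
    then show ?thesis using that[of "{}" "\<lambda>_. 0"] sA by simp
  next
    case False
    have van: "vanishes_to (Suc (\<mu> x - 1)) T (of_real x)" if "x \<in> A" for x
      using that Z(3)[of x] by (auto simp: A_def)
    have t0: "t x = 0" if "x \<in> A" for x
      using van[OF that] t[of x] that A by (auto simp: vanishes_to_Suc)
    obtain Y where Y: "finite Y" "Y \<subseteq> L" "Y \<inter> A = {}" "Suc (card Y) = card A"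
      "\<forall>y\<in>Y. deriv t y = 0"
      using rolle_points[OF \<open>is_interval L\<close> A(1) False A(2) t0 dt(1)] by auto
    show ?thesis
    proof (rule that[of "A \<union> Y" "\<lambda>x. if x \<in> A then \<mu> x - 1 else 1"])
      show "vanishes_to (if x \<in> A then \<mu> x - 1 else 1) (deriv T) (of_real x)" if x: "x \<in> A \<union> Y" for x
      proof (cases "x \<in> A")
        case True then show ?thesis using van[of x] by (simp add: vanishes_to_Suc)
      next
        case False
        then have "x \<in> Y" using x by auto
        then have "deriv T (of_real x) = 0" using Y dt(2)[of x] by auto
        then show ?thesis using False by (simp add: vanishes_to_def)
      qed
      have "sum \<mu> A = (\<Sum>x\<in>A. (\<mu> x - 1) + 1)" by (rule sum.cong) (auto simp: A_def)
      also have "\<dots> = (\<Sum>x\<in>A. \<mu> x - 1) + card A" by (simp only: sum.distrib card_eq_sum)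
      also have "(\<Sum>x\<in>A. \<mu> x - 1) = (\<Sum>x\<in>A. if x \<in> A then \<mu> x - 1 else 1)" by simp
      also have "card A = Suc (\<Sum>x\<in>Y. if x \<in> A then \<mu> x - 1 else 1)"
        using Y by (subst sum.cong[of Y Y _ "\<lambda>_. 1"]) (auto simp: disjoint_iff)
      finally show "sum \<mu> Z \<le> Suc (\<Sum>x\<in>A \<union> Y. if x \<in> A then \<mu> x - 1 else 1)"
        using A Y by (subst sum.union_disjoint) (auto simp: sA)
    qed (use A Y in auto)
  qed
qed

text \<open>
  Induction on the number of functions.  The quotients \<open>F (i + 1) / F 0\<close>, differentiated, satisfy the same
  hypothesis with one function less: if a combination of them vanishes to order \<open>k\<close> at \<open>x\<close>, then a suitable
  multiple of \<open>F 0\<close> can be subtracted from the corresponding combination of the \<open>F (i + 1)\<close> to make it vanish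
  to order \<open>k + 1\<close>.  Rolle's theorem then adds back the zero that the differentiation loses.
\<close>
lemma zero_count:
  fixes L :: "real set" and F :: "nat \<Rightarrow> complex \<Rightarrow> complex" and \<alpha> :: "nat \<Rightarrow> real"
  assumes L: "open L" "is_interval L"
    and "open U" "of_real ` L \<subseteq> U" "\<And>i. i < n \<Longrightarrow> F i holomorphic_on U"
    and "\<And>i x. i < n \<Longrightarrow> x \<in> L \<Longrightarrow> of_real (f i x) = F i (of_real x)"
    and "\<And>k \<alpha> x j. k \<le> n \<Longrightarrow> x \<in> L \<Longrightarrow>
            vanishes_to k (\<lambda>z. \<Sum>j<k. of_real (\<alpha> j) * F j z) (of_real x) \<Longrightarrow> j < k \<Longrightarrow> \<alpha> j = (0::real)"
    and "\<exists>j<n. \<alpha> j \<noteq> 0"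
    and "finite Z" "Z \<subseteq> L"
    and "\<And>x. x \<in> Z \<Longrightarrow> vanishes_to (\<mu> x) (\<lambda>z. \<Sum>j<n. of_real (\<alpha> j) * F j z) (of_real x)"
  shows "sum \<mu> Z < n"
  using assms(3-)
proof (induction n arbitrary: U F f \<alpha> Z \<mu>)
  case 0 then show ?case by simp
next
  case (Suc n)
  note U = Suc.prems(1,2) and hol = Suc.prems(3) and ext = Suc.prems(4) and nv = Suc.prems(5)
    and Z = Suc.prems(7,8,9)
  have F0: "F 0 (of_real x) \<noteq> 0" if "x \<in> L" for x
    using nv[of 1 x "\<lambda>_. 1" 0] that by (auto simp: vanishes_to_def)
  define V where "V = {z\<in>U. F 0 z \<noteq> 0}"
  have V: "open V" "of_real ` L \<subseteq> V" "V \<subseteq> U"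
  proof -
    have "V = U \<inter> F 0 -` (- {0})" by (auto simp: V_def)
    moreover have "open (U \<inter> F 0 -` (- {0}))"
      using hol[of 0] U(1) by (intro continuous_open_preimage holomorphic_on_imp_continuous_on) auto
    ultimately show "open V" by simp
  qed (use U F0 in \<open>auto simp: V_def\<close>)
  have holV: "F i holomorphic_on V" if "i < Suc n" for i
    using hol[OF that] V(3) by (rule holomorphic_on_subset)
  have V0: "F 0 z \<noteq> 0" if "z \<in> V" for z using that by (simp add: V_def)
  define Q where "Q i z = F (Suc i) z / F 0 z" for i z
  have holQ: "Q i holomorphic_on V" if "i < n" for i
    unfolding Q_def by (intro holomorphic_intros holV V0) (use that in auto)
  define G where "G i = deriv (Q i)" for i
  have holG: "G i holomorphic_on V" if "i < n" for i
    unfolding G_def by (intro holomorphic_deriv holQ V that)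
  define q where "q i x = f (Suc i) x / f 0 x" for i x
  have extQ: "of_real (q i x) = Q i (of_real x)" if "i < n" "x \<in> L" for i x
    using ext[of 0 x] ext[of "Suc i" x] that by (simp add: q_def Q_def)
  have extG: "of_real (deriv (q i) x) = G i (of_real x)" if "i < n" "x \<in> L" for i x
    unfolding G_def using real_restriction_deriv(2)[OF V(1) holQ[OF that(1)] V(2) L(1) extQ[OF that(1)] that(2)]
    by simp
  define T where "T k \<beta> z = (\<Sum>j<Suc k. of_real (\<beta> j) * F j z) * inverse (F 0 z)" for k and \<beta> :: "nat \<Rightarrow> real" and z
  have T_eq: "T k \<beta> z = of_real (\<beta> 0) + (\<Sum>j<k. of_real (\<beta> (Suc j)) * Q j z)" if "z \<in> V" for k \<beta> z
    unfolding T_def Q_def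
    by (simp add: sum.lessThan_Suc_shift V0[OF that] sum_distrib_right distrib_right
        divide_inverse mult.assoc del: sum.lessThan_Suc)
  have holT: "T k \<beta> holomorphic_on V" if "k \<le> n" for k \<beta>
    unfolding T_def by (intro holomorphic_intros holV V0) (use that in auto)
  have derT: "deriv (T k \<beta>) z = (\<Sum>j<k. of_real (\<beta> (Suc j)) * G j z)" if "k \<le> n" "z \<in> V" for k \<beta> z
  proof -
    have "((\<lambda>z. of_real (\<beta> 0) + (\<Sum>j<k. of_real (\<beta> (Suc j)) * Q j z)) has_field_derivative
        (0 + (\<Sum>j<k. of_real (\<beta> (Suc j)) * G j z))) (at z)"
      unfolding G_def
      by (intro DERIV_add DERIV_const DERIV_sum DERIV_cmult holomorphic_derivI[OF holQ V(1) that(2)])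
         (use that in auto)
    moreover have "eventually (\<lambda>w. T k \<beta> w = of_real (\<beta> 0) + (\<Sum>j<k. of_real (\<beta> (Suc j)) * Q j w)) (nhds z)"
      using V(1) that(2) T_eq by (auto simp: eventually_nhds)
    ultimately show ?thesis
      by (simp add: deriv_cong_ev DERIV_imp_deriv)
  qed
  have van_derT: "vanishes_to m (deriv (T k \<beta>)) z = vanishes_to m (\<lambda>z. \<Sum>j<k. of_real (\<beta> (Suc j)) * G j z) z"
    if "k \<le> n" "z \<in> V" for m k \<beta> z
    by (rule vanishes_to_cong) (use V(1) that derT in \<open>auto simp: eventually_nhds\<close>)
  have vanT: "vanishes_to m (\<lambda>z. \<Sum>j<Suc k. of_real (\<beta> j) * F j z) z \<longleftrightarrow> vanishes_to m (T k \<beta>) z"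
    if "k \<le> n" "z \<in> V" for m k \<beta> z
  proof
    assume "vanishes_to m (\<lambda>z. \<Sum>j<Suc k. of_real (\<beta> j) * F j z) z"
    then show "vanishes_to m (T k \<beta>) z"
      unfolding T_def using that
      by (intro vanishes_to_mult[OF _ _ V(1) that(2)] holomorphic_intros holV V0) auto
  next
    assume "vanishes_to m (T k \<beta>) z"
    then have "vanishes_to m (\<lambda>z. T k \<beta> z * F 0 z) z"
      by (intro vanishes_to_mult[OF holT holV V(1)] that) auto
    moreover have "eventually (\<lambda>w. T k \<beta> w * F 0 w = (\<Sum>j<Suc k. of_real (\<beta> j) * F j w)) (nhds z)"
      using V(1) that(2) V0 by (auto simp: eventually_nhds T_def)
    ultimately show "vanishes_to m (\<lambda>z. \<Sum>j<Suc k. of_real (\<beta> j) * F j z) z"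
      using vanishes_to_cong[of "\<lambda>w. T k \<beta> w * F 0 w" _ z] by metis
  qed
  have T_real: "of_real (\<beta> 0 + (\<Sum>j<k. \<beta> (Suc j) * q j x)) = T k \<beta> (of_real x)"
    if "k \<le> n" "x \<in> L" for k \<beta> x
    using that V(2) extQ by (subst T_eq) (auto intro!: sum.cong)
  have nvG: "\<beta> j = 0" if "k \<le> n" "x \<in> L" "j < k"
      "vanishes_to k (\<lambda>z. \<Sum>j<k. of_real (\<beta> j) * G j z) (of_real x)" for k \<beta> x j
  proof -
    have xV: "of_real x \<in> V" using V that by auto
    \<comment> \<open>the multiple of \<open>F 0\<close> that makes the quotient itself vanish at \<open>x\<close>\<close>
    define c where "c = - (\<Sum>j<k. \<beta> j * q j x)"
    define \<beta>' where "\<beta>' = case_nat c \<beta>"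
    have "T k \<beta>' (of_real x) = 0"
      using T_real[OF that(1,2), of \<beta>'] by (simp add: \<beta>'_def c_def)
    moreover have "vanishes_to k (deriv (T k \<beta>')) (of_real x)"
      using van_derT[OF that(1) xV, of k \<beta>'] that(4) by (simp add: \<beta>'_def)
    ultimately have "vanishes_to (Suc k) (T k \<beta>') (of_real x)" by (simp add: vanishes_to_Suc)
    then have "vanishes_to (Suc k) (\<lambda>z. \<Sum>j<Suc k. of_real (\<beta>' j) * F j z) (of_real x)"
      using vanT[OF that(1) xV] by blast
    then have "\<beta>' (Suc j) = 0" using nv[of "Suc k" x \<beta>' "Suc j"] that by auto
    then show ?thesis by (simp add: \<beta>'_def)
  qed
  have ZT: "vanishes_to (\<mu> x) (T n \<alpha>) (of_real x)" if "x \<in> Z" for x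
  proof -
    have "of_real x \<in> V" using V(2) Z(2) that by auto
    then show ?thesis using Z(3)[OF that] vanT[OF order_refl] by blast
  qed
  show ?case
  proof (cases "\<exists>j<n. \<alpha> (Suc j) \<noteq> 0")
    case True
    obtain Z' \<mu>' where Z': "finite Z'" "Z' \<subseteq> L"
        "\<And>x. x \<in> Z' \<Longrightarrow> vanishes_to (\<mu>' x) (deriv (T n \<alpha>)) (of_real x)"
        "sum \<mu> Z \<le> Suc (sum \<mu>' Z')"
      using rolle_multiplicities[OF V(1) holT[OF order_refl] V(2) L T_real[OF order_refl] Z(1,2) ZT]
      by blast
    have "sum \<mu>' Z' < n"
    proof (rule Suc.IH[OF V(1,2), where F = G and f = "\<lambda>i. deriv (q i)" and \<alpha> = "\<lambda>j. \<alpha> (Suc j)"])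
      fix k x j and \<beta> :: "nat \<Rightarrow> real"
      assume "k \<le> n" "x \<in> L" "j < k" "vanishes_to k (\<lambda>z. \<Sum>j<k. of_real (\<beta> j) * G j z) (of_real x)"
      then show "\<beta> j = 0" using nvG by blast
    next
      fix x assume "x \<in> Z'"
      then have "of_real x \<in> V" using Z' V by auto
      then show "vanishes_to (\<mu>' x) (\<lambda>z. \<Sum>j<n. of_real (\<alpha> (Suc j)) * G j z) (of_real x)"
        using Z'(3)[OF \<open>x \<in> Z'\<close>] van_derT[of n] by auto
    qed (use True Z' holG extG in auto)
    then show ?thesis using Z'(4) by simp
  next
    case False
    then have "\<alpha> 0 \<noteq> 0" using Suc.prems(6) by (metis less_Suc_eq_0_disj)
    have "\<mu> x = 0" if "x \<in> Z" for x
    proof (rule ccontr)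
      assume "\<mu> x \<noteq> 0"
      then have "T n \<alpha> (of_real x) = 0"
        using ZT[OF that] by (auto simp: vanishes_to_def)
      moreover have "T n \<alpha> (of_real x) = of_real (\<alpha> 0)"
        using False T_eq[of "of_real x" n \<alpha>] V(2) Z(2) that by auto
      ultimately show False using \<open>\<alpha> 0 \<noteq> 0\<close> by simp
    qed
    then show ?thesis by simp
  qed
qed

lemma real_analytic_on_restriction:
  assumes "open U" "F holomorphic_on U" "of_real ` L \<subseteq> U" "open L"
    and ext: "\<And>x. x \<in> L \<Longrightarrow> of_real (f x) = F (of_real x)"
  shows "real_analytic_on f L"
  unfolding real_analytic_on_def
proof
  fix x assume x: "x \<in> L"
  obtain r1 where r1: "r1 > 0" "ball (complex_of_real x) r1 \<subseteq> U"
    using assms x by (metis image_subset_iff open_contains_ball)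
  obtain r2 where r2: "r2 > 0" "ball x r2 \<subseteq> L"
    using assms x by (metis open_contains_ball)
  define a where "a n = (deriv ^^ n) f x / fact n" for n
  have "(\<lambda>n. a n * (y - x) ^ n) sums f y" if "\<bar>y - x\<bar> < min r1 r2" for y
  proof -
    have y: "y \<in> L" using that r2 by (auto simp: subset_eq dist_real_def)
    have "(\<lambda>n. (deriv ^^ n) F (of_real x) / fact n * (of_real y - of_real x) ^ n) sums F (of_real y)"
    proof (rule holomorphic_power_series)
      show "F holomorphic_on ball (complex_of_real x) r1" using assms r1 holomorphic_on_subset by blast
      show "of_real y \<in> ball (complex_of_real x) r1"
        using that by (simp add: dist_norm abs_minus_commute flip: of_real_diff)
    qed
    then have "(\<lambda>n. complex_of_real (a n * (y - x) ^ n)) sums of_real (f y)"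
      using real_restriction_higher_deriv[OF assms x] ext[OF y] by (simp add: a_def)
    then show ?thesis by (simp only: sums_of_real_iff)
  qed
  then show "\<exists>a r. 0 < r \<and> (\<forall>y. \<bar>y - x\<bar> < r \<longrightarrow> (\<lambda>n. a n * (y - x) ^ n) sums f y)"
    using r1 r2 by (intro exI[of _ a] exI[of _ "min r1 r2"]) auto
qed

text \<open>
  The last hypothesis says that the Wronskians of the initial segments of the family do not vanish on \<open>L\<close>.
\<close>
lemma ECT_systemI:
  fixes L :: "real set" and F :: "nat \<Rightarrow> complex \<Rightarrow> complex"
  assumes L: "open L" "is_interval L" "L \<noteq> {}"
    and U: "open U" "of_real ` L \<subseteq> U"
    and hol: "\<And>i. i < length fs \<Longrightarrow> F i holomorphic_on U"
    and ext: "\<And>i x. i < length fs \<Longrightarrow> x \<in> L \<Longrightarrow> of_real ((fs ! i) x) = F i (of_real x)"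
    and nv: "\<And>k \<alpha> x j. k \<le> length fs \<Longrightarrow> x \<in> L \<Longrightarrow>
            vanishes_to k (\<lambda>z. \<Sum>j<k. of_real (\<alpha> j) * F j z) (of_real x) \<Longrightarrow> j < k \<Longrightarrow> \<alpha> j = (0::real)"
  shows "ECT_system fs L"
  unfolding ECT_system_def
proof (intro conjI ballI allI impI)
  fix f assume "f \<in> set fs"
  then obtain i where "i < length fs" "f = fs ! i" by (metis in_set_conv_nth)
  then show "real_analytic_on f L"
    using real_analytic_on_restriction[OF U(1) hol U(2) L(1) ext] by blast
next
  fix k \<alpha> assume k: "k \<in> {1..length fs}" and \<alpha>: "\<exists>j<k. \<alpha> j \<noteq> (0::real)"
  define C where "C z = (\<Sum>j<k. of_real (\<alpha> j) * F j z)" for z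
  define c where "c = (\<lambda>x. \<Sum>j<k. \<alpha> j * (fs ! j) x)"
  define Z where "Z = {x \<in> L. c x = 0}"
  have count: "sum \<mu> A < k" if "finite A" "A \<subseteq> L" "\<And>x. x \<in> A \<Longrightarrow> vanishes_to (\<mu> x) C (of_real x)" for A \<mu>
  proof (rule zero_count[OF L(1,2) U, where F = F and f = "\<lambda>i. fs ! i" and \<alpha> = \<alpha>])
    fix m \<beta> x j
    assume "m \<le> k" "x \<in> L" "vanishes_to m (\<lambda>z. \<Sum>j<m. of_real (\<beta> j) * F j z) (of_real x)" "j < m"
    then show "\<beta> j = (0::real)" using nv[of m x \<beta> j] k by auto
  qed (use hol ext k \<alpha> that in \<open>auto simp: C_def[abs_def]\<close>)
  have holC: "C holomorphic_on U" unfolding C_def by (intro holomorphic_intros hol) (use k in auto)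
  have extC: "of_real (c x) = C (of_real x)" if "x \<in> L" for x
    using that ext k by (auto simp: c_def C_def intro!: sum.cong)
  have der: "of_real ((deriv ^^ m) c x) = (deriv ^^ m) C (of_real x)" if "x \<in> L" for m x
    using real_restriction_higher_deriv[OF U(1) holC U(2) L(1) extC that] .
  have "finite Z"
  proof (rule ccontr)
    assume "infinite Z"
    then obtain A where A: "finite A" "card A = k" "A \<subseteq> Z"
      using infinite_arbitrarily_large by blast
    have "C (of_real x) = 0" if "x \<in> A" for x
      using that A extC[of x] by (auto simp: Z_def)
    then have "sum (\<lambda>_. 1) A < k"
      using A by (intro count) (auto simp: Z_def vanishes_to_def)
    then show False using A by simp
  qed
  moreover have "\<exists>x\<in>L. c x \<noteq> 0"
  proof (rule ccontr)
    assume "\<not> ?thesis"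
    then have "Z = L" by (auto simp: Z_def)
    moreover have "infinite L" using L(1,3) finite_imp_not_open by blast
    ultimately show False using \<open>finite Z\<close> by simp
  qed
  moreover have "sum (zero_multiplicity c) Z < k"
  proof (rule count)
    fix x assume "x \<in> Z"
    then have x: "x \<in> L" by (simp add: Z_def)
    have "(deriv ^^ i) c x = 0" if "i < zero_multiplicity c x" for i
      using not_less_Least[of i "\<lambda>m. (deriv ^^ m) c x \<noteq> 0"] that by (simp add: zero_multiplicity_def)
    then show "vanishes_to (zero_multiplicity c x) C (of_real x)"
      unfolding vanishes_to_def using der[OF x] by (metis of_real_0)
  qed (use \<open>finite Z\<close> in \<open>auto simp: Z_def\<close>)
  ultimately show "let F = \<lambda>x. \<Sum>j<k. \<alpha> j * (fs ! j) x; Z = {x \<in> L. F x = 0}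
           in (\<exists>x\<in>L. F x \<noteq> 0) \<and> finite Z \<and> (\<Sum>x\<in>Z. zero_multiplicity F x) \<le> k - 1"
    unfolding Let_def c_def[symmetric] Z_def[symmetric] by auto
qed (use L in auto)

section \<open>Moments and sign changes\<close>

lemma sign_of_nonvanishing:
  fixes p :: "real \<Rightarrow> real"
  assumes "is_interval I" "continuous_on I p" "\<And>x. x \<in> I \<Longrightarrow> p x \<noteq> 0"
  obtains \<eta> where "\<eta> \<in> {1, -1::real}" "\<And>x. x \<in> I \<Longrightarrow> \<eta> * p x > 0"
proof (cases "\<exists>a\<in>I. p a > 0")
  case True
  then obtain a where a: "a \<in> I" "p a > 0" by blast
  have "p x > 0" if "x \<in> I" for x
  proof (rule ccontr)
    assume "\<not> p x > 0"
    have "is_interval (p ` I)"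
      using assms(1,2) connected_continuous_image is_interval_connected_1 by blast
    then have "0 \<in> p ` I"
      using a that \<open>\<not> p x > 0\<close> unfolding is_interval_1
      by (meson imageI less_imp_le not_less)
    then show False using assms(3) by auto
  qed
  then show ?thesis using that[of 1] by simp
next
  case False
  have "-1 * p x > 0" if "x \<in> I" for x
    using False assms(3)[OF that] that by (metis linorder_neqE_linordered_idom minus_mult_left mult_1 neg_0_less_iff_less)
  then show ?thesis using that[of "-1"] by blast
qed

text \<open>
  Not every zero is a sign change, so the polynomial uses a subset \<open>R\<close> of the zeros.  Passing a new
  largest zero \<open>b\<close>, one either keeps \<open>R\<close> or adds \<open>b\<close> to it, according to the sign on the right of \<open>b\<close>.
\<close>
lemma sign_change_polynomial:
  fixes p :: "real \<Rightarrow> real"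
  assumes "is_interval I" "continuous_on I p" "finite Z" "{x \<in> I. p x = 0} = Z"
  shows "\<exists>R \<eta>. R \<subseteq> Z \<and> \<eta> \<in> {1, -1::real} \<and> (\<forall>x\<in>I. 0 \<le> \<eta> * p x * (\<Prod>r\<in>R. x - r))"
  using assms(3,1,2,4)
proof (induction Z arbitrary: I rule: finite_linorder_max_induct)
  case empty
  obtain \<eta> where "\<eta> \<in> {1, -1::real}" "\<And>x. x \<in> I \<Longrightarrow> \<eta> * p x > 0"
    using sign_of_nonvanishing[of I p] empty by blast
  then have "\<forall>x\<in>I. 0 \<le> \<eta> * p x * (\<Prod>r\<in>{}. x - r)" by (simp add: less_imp_le)
  then show ?case using \<open>\<eta> \<in> _\<close> by blast
next
  case (insert b A)
  have b: "b \<in> I" "p b = 0" and bA: "b \<notin> A" using insert.prems(3) insert.hyps by auto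
  have int: "is_interval (I \<inter> {..<b})" "is_interval (I \<inter> {b<..})"
    using insert.prems(1) by (auto simp: is_interval_Int)
  have cont: "continuous_on (I \<inter> {..<b}) p" "continuous_on (I \<inter> {b<..}) p"
    using insert.prems(2) by (auto intro: continuous_on_subset)
  have "{x \<in> I \<inter> {..<b}. p x = 0} = A"
    using insert.prems(3) insert.hyps(2) bA by auto
  then obtain R \<eta> where R: "R \<subseteq> A" "\<eta> \<in> {1, -1::real}"
      "\<And>x. x \<in> I \<Longrightarrow> x < b \<Longrightarrow> 0 \<le> \<eta> * p x * (\<Prod>r\<in>R. x - r)"
    using insert.IH[OF int(1) cont(1)] by fastforce
  have "p x \<noteq> 0" if "x \<in> I \<inter> {b<..}" for x
    using insert.prems(3) insert.hyps(2) that by force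
  then obtain \<epsilon> where \<epsilon>: "\<epsilon> \<in> {1, -1::real}" "\<And>x. x \<in> I \<Longrightarrow> x > b \<Longrightarrow> \<epsilon> * p x > 0"
    using sign_of_nonvanishing[OF int(2) cont(2)] by (metis IntI greaterThan_iff)
  have "finite R" "b \<notin> R" using R(1) insert.hyps bA by (auto intro: finite_subset)
  have pos: "(\<Prod>r\<in>R. x - r) > 0" if "x \<ge> b" for x
    by (rule prod_pos) (use R(1) insert.hyps that in force)
  have right: "0 \<le> \<epsilon> * p x * (\<Prod>r\<in>R. x - r)" if "x \<in> I" "x > b" for x
    using \<epsilon>(2)[OF that] pos[of x] that by (simp add: less_imp_le)
  show ?case
  proof (cases "\<epsilon> = \<eta>")
    case eq: True
    have "0 \<le> \<eta> * p x * (\<Prod>r\<in>R. x - r)" if "x \<in> I" for x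
      using R(3)[of x] right[of x] that b eq by (cases x b rule: linorder_cases) auto
    moreover have "R \<subseteq> insert b A" using R(1) by auto
    ultimately show ?thesis using R(2) by blast
  next
    case neq: False
    then have "\<epsilon> = - \<eta>" using R(2) \<epsilon>(1) by auto
    have "0 \<le> \<epsilon> * p x * (\<Prod>r\<in>insert b R. x - r)" if "x \<in> I" for x
    proof (cases x b rule: linorder_cases)
      case less
      have "0 \<le> (b - x) * (\<eta> * p x * (\<Prod>r\<in>R. x - r))"
        by (rule mult_nonneg_nonneg) (use less R(3)[of x] that in auto)
      also have "\<dots> = \<epsilon> * p x * ((x - b) * (\<Prod>r\<in>R. x - r))"
        unfolding \<open>\<epsilon> = - \<eta>\<close> by algebra
      finally show ?thesis using \<open>finite R\<close> \<open>b \<notin> R\<close> by simp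
    next
      case greater
      have "0 \<le> (x - b) * (\<epsilon> * p x * (\<Prod>r\<in>R. x - r))"
        by (rule mult_nonneg_nonneg) (use greater right[of x] that in auto)
      also have "\<dots> = \<epsilon> * p x * ((x - b) * (\<Prod>r\<in>R. x - r))" by algebra
      finally show ?thesis using \<open>finite R\<close> \<open>b \<notin> R\<close> by simp
    qed (use b in auto)
    moreover have "insert b R \<subseteq> insert b A" using R(1) by auto
    ultimately show ?thesis using \<epsilon>(1) by blast
  qed
qed

text \<open>
  If all these moments vanished, \<open>\<kappa>\<close> would be orthogonal to \<open>\<sigma> ^ m * P \<sigma>\<close> with \<open>\<sigma> = sin\<^sup>2 \<theta>\<close> and \<open>P\<close> the
  polynomial with the sign changes of \<open>\<kappa>\<close>.  The integrand has one sign, so it would be zero throughout.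
\<close>
lemma nonzero_moment:
  fixes \<kappa> :: "real \<Rightarrow> real"
  assumes cont: "continuous_on {0..1} \<kappa>"
    and Z: "finite {x \<in> {0<..<1}. \<kappa> x = 0}" "card {x \<in> {0<..<1}. \<kappa> x = 0} < n"
  shows "\<exists>j<n. integral {0..2*pi} (\<lambda>\<theta>. \<kappa> ((sin \<theta>)\<^sup>2) * ((sin \<theta>)\<^sup>2) ^ (m + j)) \<noteq> 0"
proof (rule ccontr)
  assume "\<not> ?thesis"
  then have mom: "integral {0..2*pi} (\<lambda>\<theta>. \<kappa> ((sin \<theta>)\<^sup>2) * ((sin \<theta>)\<^sup>2) ^ (m + j)) = 0" if "j < n" for j
    using that by blast
  define Z where "Z = {x \<in> {0<..<1}. \<kappa> x = 0}"
  obtain R \<eta> where R: "R \<subseteq> Z" "\<eta> \<in> {1, -1::real}"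
      "\<And>x. x \<in> {0<..<1} \<Longrightarrow> 0 \<le> \<eta> * \<kappa> x * (\<Prod>r\<in>R. x - r)"
    using sign_change_polynomial[of "{0<..<1}" \<kappa> Z] Z(1) continuous_on_subset[OF cont, of "{0<..<1}"]
    unfolding Z_def by (force simp: is_interval_oo)
  have "finite R" "card R < n"
    using R(1) Z by (auto simp: Z_def intro: finite_subset) (meson card_mono le_less_trans)
  define P where "P = (\<Prod>r\<in>R. [:-r, 1:])"
  have polyP: "poly P x = (\<Prod>r\<in>R. x - r)" for x by (simp add: P_def poly_prod)
  have degP: "degree P < n"
    using degree_prod_sum_le[OF \<open>finite R\<close>, of "\<lambda>r. [:-r, 1:]"] \<open>card R < n\<close>
    by (simp add: P_def)
  have contS: "continuous_on {0..2*pi} (\<lambda>\<theta>. \<kappa> ((sin \<theta>)\<^sup>2))"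
    by (rule continuous_on_compose2[OF cont]) (auto intro!: continuous_intros simp: power2_le_iff_abs_le abs_square_le_1)
  define g where "g \<theta> = \<eta> * \<kappa> ((sin \<theta>)\<^sup>2) * poly P ((sin \<theta>)\<^sup>2) * ((sin \<theta>)\<^sup>2) ^ m" for \<theta>
  have contg: "continuous_on {0..2*pi} g"
    unfolding g_def by (intro continuous_intros contS)
  have "integral {0..2*pi} g =
      integral {0..2*pi} (\<lambda>\<theta>. \<Sum>j\<le>degree P. (\<eta> * coeff P j) * (\<kappa> ((sin \<theta>)\<^sup>2) * ((sin \<theta>)\<^sup>2) ^ (m + j)))"
    unfolding g_def poly_altdef
    by (simp add: sum_distrib_left sum_distrib_right power_add mult_ac)
  also have "\<dots> = (\<Sum>j\<le>degree P. integral {0..2*pi} (\<lambda>\<theta>. (\<eta> * coeff P j) * (\<kappa> ((sin \<theta>)\<^sup>2) * ((sin \<theta>)\<^sup>2) ^ (m + j))))"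
    by (intro integral_sum finite_atMost integrable_continuous_interval continuous_intros contS)
  also have "\<dots> = 0" using mom degP by (intro sum.neutral) auto
  finally have "integral {0..2*pi} g = 0" .
  moreover have nonneg: "g \<theta> \<ge> 0" for \<theta>
  proof -
    have "0 \<le> \<eta> * \<kappa> x * (\<Prod>r\<in>R. x - r)" if "x \<in> {0..1}" for x
    proof (rule continuous_ge_on_closure[where S = "{0<..<1}" and f = "\<lambda>x. \<eta> * \<kappa> x * (\<Prod>r\<in>R. x - r)"])
      show "continuous_on (closure {0<..<1}) (\<lambda>x. \<eta> * \<kappa> x * (\<Prod>r\<in>R. x - r))"
        using cont by (auto intro!: continuous_intros)
    qed (use R(3) that in auto)
    then show ?thesis
      by (simp add: g_def polyP abs_square_le_1)
  qed
  ultimately have g0: "g \<theta> = 0" if "\<theta> \<in> {0..2*pi}" for \<theta>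
    using integral_eq_0_iff[OF contg] that by auto
  have "x \<in> Z" if "x \<in> {0<..<1}" for x
  proof -
    have sx: "sqrt x \<in> {0<..<1}" using that by auto
    then have m: "- 1 \<le> sqrt x" "sqrt x \<le> 1" unfolding greaterThanLessThan_iff by linarith+
    have s: "(sin (arcsin (sqrt x)))\<^sup>2 = x" 
      using that m by simp
    have "g (arcsin (sqrt x)) = 0"
    proof (rule g0)
      have "0 \<le> arcsin (sqrt x)" using sx arcsin_le_arcsin[of 0 "sqrt x"] by auto
      moreover have "arcsin (sqrt x) \<le> pi / 2" using arcsin_bounded[OF m] by auto
      ultimately show "arcsin (sqrt x) \<in> {0..2*pi}" using pi_ge_zero by simp
    qed
    then have "\<kappa> x = 0 \<or> x \<in> R" using that R(2) \<open>finite R\<close> unfolding g_def s polyP by auto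
    then show ?thesis using that R(1) by (auto simp: Z_def)
  qed
  then have "{0<..<1::real} \<subseteq> Z" by blast
  then show False using Z(1) infinite_Ioo[of 0 "1::real"] unfolding Z_def
    by (meson finite_subset zero_less_one)
qed

section \<open>Circle moments and their derivatives\<close>

text \<open>
  With \<open>a = z cos\<^sup>2 \<theta>\<close> this is, up to a factor, the Abel transform
  \<open>\<integral> K(a) a\<^bsup>-1/2\<^esup> (z - a)\<^bsup>j-1/2\<^esup> da\<close> over \<open>(0, z)\<close>.  The trigonometric form has no singular integrand and makes
  sense for complex \<open>z\<close>.
\<close>
definition circle_moment :: "(complex \<Rightarrow> complex) \<Rightarrow> nat \<Rightarrow> complex \<Rightarrow> complex" where
  "circle_moment K j z =
     z ^ j * integral {0..2*pi} (\<lambda>\<theta>. K (z * of_real ((cos \<theta>)\<^sup>2)) * of_real (((sin \<theta>)\<^sup>2) ^ j))"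

text \<open>
  The formula is the derivative of \<open>(z - a)\<^bsup>j+1/2\<^esup>\<close> under the Abel transform.  In the variable \<open>\<theta>\<close> one
  differentiates under the integral sign and removes \<open>K'\<close> by integrating the derivative of
  \<open>K(z cos\<^sup>2 \<theta>) sin\<^bsup>2j+1\<^esup> \<theta> cos \<theta>\<close> over a period.
\<close>
lemma circle_moment_has_derivative:
  assumes K: "K holomorphic_on ball 0 1" and z: "z \<in> ball 0 1"
  shows "(circle_moment K (Suc j) has_field_derivative (2 * of_nat j + 1) / 2 * circle_moment K j z) (at z)"
proof -
  define c s where "c \<theta> = complex_of_real (cos \<theta>)" and "s \<theta> = complex_of_real (sin \<theta>)" for \<theta>
  have in_ball: "w * (c \<theta>)\<^sup>2 \<in> ball 0 1" if "w \<in> ball 0 1" for w \<theta>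
  proof -
    have "norm (w * (c \<theta>)\<^sup>2) \<le> norm w * 1"
      unfolding norm_mult c_def
      by (intro mult_left_mono) (auto simp: norm_power abs_square_le_1)
    also have "\<dots> < 1" using that by simp
    finally show ?thesis unfolding mem_ball_0 .
  qed
  have dK: "(K has_field_derivative deriv K w) (at w)" if "w \<in> ball 0 1" for w
    using K that by (intro holomorphic_derivI) auto
  have contK: "continuous_on (ball 0 1) K" "continuous_on (ball 0 1) (deriv K)"
    using K by (auto intro!: holomorphic_on_imp_continuous_on holomorphic_deriv)
  have cont1: "continuous_on {0..2*pi} (\<lambda>\<theta>. L (w * (c \<theta>)\<^sup>2))"
    if "w \<in> ball 0 1" "continuous_on (ball 0 1) L" for w and L :: "complex \<Rightarrow> complex"
    by (rule continuous_on_compose2[OF that(2)])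
       (use in_ball[OF that(1)] in \<open>auto simp: c_def simp del: mem_ball_0 mem_ball intro!: continuous_intros\<close>)
  define J where "J i w = integral {0..2*pi} (\<lambda>\<theta>. K (w * (c \<theta>)\<^sup>2) * (s \<theta>) ^ (2 * i))" for i w
  define D where "D = integral {0..2*pi} (\<lambda>\<theta>. deriv K (z * (c \<theta>)\<^sup>2) * (c \<theta>)\<^sup>2 * (s \<theta>) ^ (2 * Suc j))"
  have "((\<lambda>w. integral (cbox 0 (2*pi)) (\<lambda>\<theta>. K (w * (c \<theta>)\<^sup>2) * (s \<theta>) ^ (2 * Suc j)))
      has_field_derivative integral (cbox 0 (2*pi)) (\<lambda>\<theta>. deriv K (z * (c \<theta>)\<^sup>2) * (c \<theta>)\<^sup>2 * (s \<theta>) ^ (2 * Suc j)))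
      (at z within ball 0 1)"
  proof (rule leibniz_rule_field_derivative)
    fix w \<theta> assume "w \<in> ball (0::complex) 1"
    have "((\<lambda>w. K (w * (c \<theta>)\<^sup>2)) has_field_derivative deriv K (w * (c \<theta>)\<^sup>2) * (1 * (c \<theta>)\<^sup>2)) (at w)"
      by (rule DERIV_chain2[where f = K, OF dK], rule in_ball[OF \<open>w \<in> ball 0 1\<close>]) (auto intro!: derivative_eq_intros)
    then have "((\<lambda>w. K (w * (c \<theta>)\<^sup>2) * (s \<theta>) ^ (2 * Suc j)) has_field_derivative
      deriv K (w * (c \<theta>)\<^sup>2) * (1 * (c \<theta>)\<^sup>2) * (s \<theta>) ^ (2 * Suc j)) (at w)"
      by (rule DERIV_cmult_right)
    then show "((\<lambda>w. K (w * (c \<theta>)\<^sup>2) * (s \<theta>) ^ (2 * Suc j)) has_field_derivative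
      deriv K (w * (c \<theta>)\<^sup>2) * (c \<theta>)\<^sup>2 * (s \<theta>) ^ (2 * Suc j)) (at w within ball 0 1)"
      by (simp add: has_field_derivative_at_within)
  next
    fix w assume "w \<in> ball (0::complex) 1"
    then show "(\<lambda>\<theta>. K (w * (c \<theta>)\<^sup>2) * (s \<theta>) ^ (2 * Suc j)) integrable_on cbox 0 (2*pi)"
      unfolding cbox_interval
      by (intro integrable_continuous_interval continuous_on_mult cont1 contK)
         (auto simp: s_def intro!: continuous_intros)
  next
    have "continuous_on (ball 0 1 \<times> cbox 0 (2*pi)) (\<lambda>p. deriv K (fst p * (c (snd p))\<^sup>2))"
      by (rule continuous_on_compose2[OF contK(2)])
         (use in_ball in \<open>auto simp: c_def simp del: mem_ball_0 mem_ball intro!: continuous_intros\<close>)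
    then show "continuous_on (ball 0 1 \<times> cbox 0 (2*pi))
       (\<lambda>(w, \<theta>). deriv K (w * (c \<theta>)\<^sup>2) * (c \<theta>)\<^sup>2 * (s \<theta>) ^ (2 * Suc j))"
      unfolding case_prod_unfold
      by (intro continuous_on_mult) (auto simp: c_def s_def intro!: continuous_intros)
  qed (use z in auto)
  then have dJ: "(J (Suc j) has_field_derivative D) (at z)"
    unfolding J_def[abs_def] D_def cbox_interval at_within_open[OF z open_ball] .
  define B where "B \<theta> = K (z * (c \<theta>)\<^sup>2) * ((s \<theta>) ^ (2 * j + 1) * c \<theta>)" for \<theta>
  define B' where "B' \<theta> = (2 * of_nat j + 1) * (K (z * (c \<theta>)\<^sup>2) * (s \<theta>) ^ (2 * j))
      - (2 * of_nat (Suc j)) * (K (z * (c \<theta>)\<^sup>2) * (s \<theta>) ^ (2 * Suc j))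
      - 2 * z * (deriv K (z * (c \<theta>)\<^sup>2) * (c \<theta>)\<^sup>2 * (s \<theta>) ^ (2 * Suc j))" for \<theta>
  have "(B has_vector_derivative B' \<theta>) (at \<theta> within {0..2*pi})" for \<theta>
  proof -
    have dc: "(c has_vector_derivative - s \<theta>) (at \<theta>)"
      using bounded_linear.has_vector_derivative[OF bounded_linear_of_real, of cos "- sin \<theta>" "at \<theta>"]
        DERIV_cos[of \<theta>]
      by (simp add: has_real_derivative_iff_has_vector_derivative c_def[abs_def] s_def[abs_def])
    have ds: "(s has_vector_derivative c \<theta>) (at \<theta>)"
      using bounded_linear.has_vector_derivative[OF bounded_linear_of_real, of sin "cos \<theta>" "at \<theta>"]
        DERIV_sin[of \<theta>]
      by (simp add: has_real_derivative_iff_has_vector_derivative c_def[abs_def] s_def[abs_def])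
    have dp: "((\<lambda>w. K (z * w\<^sup>2)) has_field_derivative deriv K (z * (c \<theta>)\<^sup>2) * (z * (2 * c \<theta>))) (at (c \<theta>))"
      by (rule DERIV_chain2[where f = K, OF dK], rule in_ball[OF z]) (auto intro!: derivative_eq_intros)
    have d1: "((\<lambda>\<theta>. K (z * (c \<theta>)\<^sup>2)) has_vector_derivative (- s \<theta>) * (deriv K (z * (c \<theta>)\<^sup>2) * (z * (2 * c \<theta>)))) (at \<theta>)"
      using field_vector_diff_chain_at[OF dc dp] by (simp add: o_def)
    have "((\<lambda>w. w ^ (2 * j + 1)) has_field_derivative of_nat (2 * j + 1) * (s \<theta>) ^ (2 * j)) (at (s \<theta>))"
      by (rule DERIV_cong, rule DERIV_power[OF DERIV_ident]) simp
    from field_vector_diff_chain_at[OF ds this]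
    have d2: "((\<lambda>\<theta>. (s \<theta>) ^ (2 * j + 1)) has_vector_derivative c \<theta> * (of_nat (2 * j + 1) * (s \<theta>) ^ (2 * j))) (at \<theta>)"
      by (simp add: o_def)
    have c2: "(c \<theta>)\<^sup>2 = 1 - (s \<theta>)\<^sup>2"
      unfolding c_def s_def by (metis cos_squared_eq of_real_1 of_real_diff of_real_power)
    have "(B has_vector_derivative
        K (z * (c \<theta>)\<^sup>2) * ((s \<theta>) ^ (2 * j + 1) * (- s \<theta>) + (c \<theta> * (of_nat (2 * j + 1) * (s \<theta>) ^ (2 * j))) * c \<theta>)
        + ((- s \<theta>) * (deriv K (z * (c \<theta>)\<^sup>2) * (z * (2 * c \<theta>)))) * ((s \<theta>) ^ (2 * j + 1) * c \<theta>)) (at \<theta>)"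
      unfolding B_def by (intro has_vector_derivative_mult d1 d2 dc)
    also have "K (z * (c \<theta>)\<^sup>2) * ((s \<theta>) ^ (2 * j + 1) * (- s \<theta>) + (c \<theta> * (of_nat (2 * j + 1) * (s \<theta>) ^ (2 * j))) * c \<theta>)
        + ((- s \<theta>) * (deriv K (z * (c \<theta>)\<^sup>2) * (z * (2 * c \<theta>)))) * ((s \<theta>) ^ (2 * j + 1) * c \<theta>)
        = (2 * of_nat j + 1) * (K (z * (c \<theta>)\<^sup>2) * (s \<theta>) ^ (2 * j) * (c \<theta>)\<^sup>2)
          - K (z * (c \<theta>)\<^sup>2) * ((s \<theta>)\<^sup>2 * (s \<theta>) ^ (2 * j))
          - 2 * z * (deriv K (z * (c \<theta>)\<^sup>2) * (c \<theta>)\<^sup>2 * ((s \<theta>)\<^sup>2 * (s \<theta>) ^ (2 * j)))"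
      by (simp add: power2_eq_square algebra_simps)
    also have "\<dots> = B' \<theta>"
    proof -
      have "(2 * n + 1) * (k * p * C) - k * (S * p) - 2 * z * (d * C * (S * p))
          = (2 * n + 1) * (k * p) - (2 * (n + 1)) * (k * (S * p)) - 2 * z * (d * C * (S * p))"
        if "C = 1 - S" for k p d C S n :: complex
        using that by algebra
      from this[OF c2, of "of_nat j"] show ?thesis
        unfolding B'_def by (simp add: power2_eq_square mult.assoc add.commute)
    qed
    finally show ?thesis by (rule has_vector_derivative_at_within)
  qed
  then have "(B' has_integral (B (2*pi) - B 0)) {0..2*pi}"
    by (intro fundamental_theorem_of_calculus) auto
  moreover have "B (2*pi) = 0" "B 0 = 0" by (auto simp: B_def s_def)
  ultimately have B'0: "integral {0..2*pi} B' = 0" by (simp add: integral_unique)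
  have int: "(\<lambda>\<theta>. K (z * (c \<theta>)\<^sup>2) * (s \<theta>) ^ i) integrable_on {0..2*pi}"
            "(\<lambda>\<theta>. deriv K (z * (c \<theta>)\<^sup>2) * (c \<theta>)\<^sup>2 * (s \<theta>) ^ i) integrable_on {0..2*pi}" for i
    using z by (auto intro!: integrable_continuous_interval continuous_on_mult cont1 contK)
       (auto simp: c_def s_def intro!: continuous_intros)
  have "integral {0..2*pi} B' = (2 * of_nat j + 1) * J j z - 2 * of_nat (Suc j) * J (Suc j) z - 2 * z * D"
    unfolding B'_def J_def D_def
    by (simp only: integral_diff integral_mult_right integrable_diff integrable_on_mult_right int)
  with B'0 have key: "(2 * of_nat j + 1) * J j z = 2 * of_nat (Suc j) * J (Suc j) z + 2 * z * D"
    by algebra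
  have cm: "circle_moment K i w = w ^ i * J i w" for i w
    by (simp add: circle_moment_def J_def c_def s_def power_mult)
  have "((\<lambda>w. w ^ Suc j) has_field_derivative of_nat (Suc j) * z ^ j) (at z)"
    by (rule DERIV_cong, rule DERIV_power[OF DERIV_ident]) simp
  from DERIV_mult[OF this dJ]
  have "((\<lambda>w. w ^ Suc j * J (Suc j) w) has_field_derivative
      (of_nat (Suc j) * z ^ j) * J (Suc j) z + D * z ^ Suc j) (at z)" .
  also have "(of_nat (Suc j) * z ^ j) * J (Suc j) z + D * z ^ Suc j
      = z ^ j / 2 * (2 * of_nat (Suc j) * J (Suc j) z + 2 * z * D)"
    by (simp add: algebra_simps)
  also have "\<dots> = (2 * of_nat j + 1) / 2 * circle_moment K j z"
    unfolding key[symmetric] cm by simp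
  finally show ?thesis unfolding cm[abs_def] .
qed

section \<open>The line integrals over the ovals\<close>

text \<open>Near \<open>t\<close> the continuous logarithm is \<open>q t + Ln (p s / p t)\<close>.\<close>
lemma continuous_log_has_vector_derivative:
  fixes p q :: "real \<Rightarrow> complex"
  assumes "isCont q t" "open S" "t \<in> S" and pq: "\<And>s. s \<in> S \<Longrightarrow> p s = exp (q s)"
    and p': "(p has_vector_derivative p') (at t)"
  shows "(q has_vector_derivative p' / p t) (at t)"
proof -
  obtain d where d: "d > 0" "\<And>s. dist s t < d \<Longrightarrow> dist (q s) (q t) < pi"
    using assms(1) pi_gt_zero unfolding continuous_at_eps_delta by blast
  have "p t \<noteq> 0" using pq[OF \<open>t \<in> S\<close>] by simp
  then have "((\<lambda>z. q t + Ln (z / p t)) has_field_derivative 1 / p t) (at (p t))"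
    by (auto intro!: derivative_eq_intros)
  from field_vector_diff_chain_at[OF p' this]
  have 1: "((\<lambda>s. q t + Ln (p s / p t)) has_vector_derivative p' / p t) (at t)"
    by (simp add: o_def)
  show ?thesis
  proof (rule has_vector_derivative_transform_within_open[OF 1])
    show "open (S \<inter> ball t d)" "t \<in> S \<inter> ball t d" using assms d by auto
    fix s assume s: "s \<in> S \<inter> ball t d"
    then have "norm (q s - q t) < pi" using d(2)[of s] by (simp add: dist_commute flip: dist_norm)
    then have "\<bar>Im (q s - q t)\<bar> < pi" using abs_Im_le_cmod[of "q s - q t"] by linarith
    then have "Ln (exp (q s - q t)) = q s - q t" by (intro Ln_exp) auto
    moreover have "p s / p t = exp (q s - q t)" using pq s \<open>t \<in> S\<close> by (simp add: exp_diff)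
    ultimately show "q t + Ln (p s / p t) = q s" by simp
  qed
qed

lemma periodic_primitive:
  fixes E \<Phi> :: "real \<Rightarrow> real"
  assumes \<Phi>: "\<And>x. (\<Phi> has_real_derivative E x) (at x)" and per: "\<And>x. E (x + 2*pi) = E x"
  shows "\<Phi> (x + 2*pi) - \<Phi> x = integral {0..2*pi} E"
proof -
  have "((\<lambda>x. \<Phi> (x + 2*pi) - \<Phi> x) has_real_derivative E (x + 2*pi) * 1 - E x) (at x)" for x
    by (intro DERIV_diff \<Phi> DERIV_chain2[OF \<Phi>]) (auto intro!: derivative_eq_intros)
  then have "\<Phi> (x + 2*pi) - \<Phi> x = \<Phi> (0 + 2*pi) - \<Phi> 0"
    by (intro DERIV_isconst_all[of "\<lambda>x. \<Phi> (x + 2*pi) - \<Phi> x"]) (simp add: per)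
  also have "\<dots> = integral {0..2*pi} E"
    using fundamental_theorem_of_calculus[of 0 "2*pi" \<Phi> E] \<Phi>
    by (auto simp: has_real_derivative_iff_has_vector_derivative has_vector_derivative_at_within
        intro!: integral_unique[symmetric])
  finally show ?thesis .
qed

lemma continuous_primitive:
  fixes E :: "real \<Rightarrow> real"
  assumes "continuous_on UNIV E"
  obtains \<Phi> where "\<And>x. (\<Phi> has_real_derivative E x) (at x)"
proof -
  have "isCont E x" for x using assms by (simp add: continuous_on_eq_continuous_at)
  then obtain \<Phi> where "\<forall>x. (\<Phi> has_vector_derivative E x) (at x)"
    using einterval_antiderivative[of "-\<infinity>" \<infinity> E] by auto
  then show ?thesis using that[of \<Phi>] by (simp add: has_real_derivative_iff_has_vector_derivative)
qed

definition oval_weight :: "real \<Rightarrow> real \<Rightarrow> real" where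
  "oval_weight h \<theta> = sqrt (1 - h * (cos \<theta>)\<^sup>2)"

text \<open>
  The image of the oval on the circle has a continuous logarithm \<open>q\<close>, whose imaginary part \<open>\<theta>\<close> increases by
  \<open>2 \<pi>\<close> times the winding number.  The winding number is that of the oval itself, because the map to the circle
  preserves the signs of both coordinates, so the segments joining a point to its image avoid \<open>0\<close>.  In terms
  of \<open>\<theta>\<close> the integrand is \<open>- \<surd>2 h\<^sup>2\<close> times \<open>E(\<theta>) \<theta>' + \<surd>h N(sin \<theta>) cos \<theta> \<theta>'\<close>; the second summand is
  exact on the circle and contributes nothing.
\<close>
lemma oval_line_integral:
  fixes g :: "real \<Rightarrow> complex"
  assumes g: "parametrizes_oval g h" and h: "0 < h" "h < 1"
    and f: "\<And>x. -1 < x \<Longrightarrow> x < 1 \<Longrightarrow> f x = (1 + x) ^ 3 * (e (1 - x\<^sup>2) + x * d (1 - x\<^sup>2))"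
    and cont: "continuous_on {0<..} e" "continuous_on {0<..} d"
  shows "line_integral_dx g (\<lambda>x y. f x * y ^ 3) = - Re (winding_number g 0) * sqrt 2 * h\<^sup>2 *
      integral {0..2*pi} (\<lambda>\<theta>. sqrt (1 + oval_weight h \<theta>) / oval_weight h \<theta> * e (oval_weight h \<theta>) * (sin \<theta>) ^ 4)"
proof -
  define E where "E \<theta> = sqrt (1 + oval_weight h \<theta>) / oval_weight h \<theta> * e (oval_weight h \<theta>) * (sin \<theta>) ^ 4" for \<theta>
  define v where "v s = sqrt (1 - h + h * s\<^sup>2)" for s
  define N where "N s = d (v s) / v s * s ^ 4" for s
  have w_v: "oval_weight h \<theta> = v (sin \<theta>)" for \<theta>
    by (simp add: oval_weight_def v_def cos_squared_eq algebra_simps)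
  have vpos: "v s > 0" for s
    using h by (simp add: v_def add_pos_nonneg)
  have contv: "continuous_on UNIV v" unfolding v_def by (intro continuous_intros)
  have contN: "continuous_on UNIV N" unfolding N_def
    by (intro continuous_intros contv continuous_on_compose2[OF cont(2) contv])
       (use vpos in \<open>auto simp: less_imp_neq[symmetric]\<close>)
  have contE: "continuous_on UNIV E"
  proof -
    have c: "continuous_on UNIV (\<lambda>\<theta>. v (sin \<theta>))"
      by (intro continuous_on_compose2[OF contv] continuous_intros) auto
    have "continuous_on UNIV (\<lambda>\<theta>. e (v (sin \<theta>)))"
      by (rule continuous_on_compose2[OF cont(1) c]) (use vpos in auto)
    then show ?thesis unfolding E_def w_v
      by (intro continuous_intros c) (use vpos in \<open>auto simp: less_imp_neq[symmetric]\<close>)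
  qed
  obtain \<Phi> where \<Phi>: "\<And>x. (\<Phi> has_real_derivative E x) (at x)"
    using continuous_primitive[OF contE] by blast
  obtain R where R: "\<And>x. (R has_real_derivative N x) (at x)"
    using continuous_primitive[OF contN] by blast

  define x y where "x t = Re (g t)" and "y t = Im (g t)" for t
  define X Y where "X t = x t * sqrt (2 - (x t)\<^sup>2)" and "Y t = (1 + x t) * y t / sqrt 2" for t
  define W where "W t = 1 - (x t)\<^sup>2" for t
  define p where "p t = of_real (X t) + \<i> * of_real (Y t)" for t
  have path: "valid_path g" "path g" "simple_path g" "pathfinish g = pathstart g" "0 \<in> inside (path_image g)"
    using g by (auto simp: parametrizes_oval_def valid_path_imp_path)
  have gH: "H (x t) (y t) = h" "-1 < x t" "x t < 1" if "t \<in> {0..1}" for t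
    using g that unfolding parametrizes_oval_def x_def y_def path_image_def
    by (auto simp: image_subset_iff)
  have xsq: "(x t)\<^sup>2 < 1" if "t \<in> {0..1}" for t
    using gH[OF that] by (simp add: abs_square_less_1)
  have Wpos: "W t > 0" if "t \<in> {0..1}" for t using xsq[OF that] by (simp add: W_def)
  have s2: "2 - (x t)\<^sup>2 = 1 + W t" for t by (simp add: W_def)
  have X2: "(X t)\<^sup>2 = 1 - (W t)\<^sup>2" if "t \<in> {0..1}" for t
    using xsq[OF that] by (simp add: X_def W_def power_mult_distrib power2_eq_square algebra_simps)
  have circ: "(X t)\<^sup>2 + (Y t)\<^sup>2 = h" if "t \<in> {0..1}" for t
    using gH(1)[OF that] xsq[OF that]
    by (simp add: X_def Y_def H_def power_mult_distrib power_divide)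
  have contg: "continuous_on {0..1} g" using path(2) by (simp add: path_def)
  have contxy: "continuous_on {0..1} x" "continuous_on {0..1} y"
    unfolding x_def y_def by (intro continuous_intros contg)+
  have pathp: "path p"
    unfolding path_def p_def X_def Y_def by (intro continuous_intros contxy) auto
  have norm_p: "norm (p t) = sqrt h" if "t \<in> {0..1}" for t
    using circ[OF that] by (simp add: cmod_def p_def)
  have p0: "p t \<noteq> 0" if "t \<in> {0..1}" for t
    using norm_p[OF that] h by auto
  have loop_p: "pathfinish p = pathstart p"
    using path(4) by (simp add: p_def X_def Y_def x_def y_def pathfinish_def pathstart_def)
  have wn: "winding_number p 0 = winding_number g 0"
  proof (rule winding_number_loops_linear_eq[OF path(2) pathp path(4) loop_p])
    fix t :: real assume t: "t \<in> {0..1}"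
    show "0 \<notin> closed_segment (g t) (p t)"
    proof
      assume "0 \<in> closed_segment (g t) (p t)"
      then obtain u where u: "0 \<le> u" "u \<le> 1" "0 = (1 - u) *\<^sub>R g t + u *\<^sub>R p t"
        by (auto simp: closed_segment_def)
      have "0 = x t * ((1 - u) + u * sqrt (2 - (x t)\<^sup>2))"
        using arg_cong[OF u(3), of Re] by (simp add: x_def[symmetric] p_def X_def algebra_simps)
      moreover have "0 = y t * ((1 - u) + u * ((1 + x t) / sqrt 2))"
        using arg_cong[OF u(3), of Im] by (simp add: y_def[symmetric] p_def Y_def algebra_simps)
      moreover have "(1 - u) + u * c > 0" if "c > 0" for c :: real
        using u that by (cases "u = 1") (auto simp: add_pos_nonneg)
      moreover have "sqrt (2 - (x t)\<^sup>2) > 0" "(1 + x t) / sqrt 2 > 0"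
        using gH[OF t] xsq[OF t] by auto
      ultimately have "x t = 0" "y t = 0"
        by (metis mult_eq_0_iff order_less_irrefl)+
      then show False using gH(1)[OF t] h by (simp add: H_def)
    qed
  qed
  define \<sigma> where "\<sigma> = Re (winding_number g 0)"
  have \<sigma>: "winding_number g 0 = of_real \<sigma>" "\<sigma> = 1 \<or> \<sigma> = -1"
    using simple_closed_path_winding_number_inside[OF path(3)] path(5) unfolding \<sigma>_def
    by (smt (verit) Re_complex_of_real of_real_1 of_real_minus)+
  have "0 \<notin> path_image p" using p0 by (auto simp: path_image_def)
  then obtain q where q: "path q" "pathfinish q - pathstart q = 2 * of_real pi * \<i> * winding_number p 0"
      "\<And>t. t \<in> {0..1} \<Longrightarrow> p t = 0 + exp (q t)"
    using winding_number_as_continuous_log[OF pathp] by blast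
  define \<theta> where "\<theta> t = Im (q t)" for t
  have contq: "continuous_on {0..1} q" using q(1) by (simp add: path_def)
  have cont\<theta>: "continuous_on {0..1} \<theta>" unfolding \<theta>_def by (intro continuous_intros contq)
  have turn: "\<theta> 1 = \<theta> 0 + 2 * pi * \<sigma>"
    using arg_cong[OF q(2), of Im] by (simp add: wn \<sigma>(1) \<theta>_def pathfinish_def pathstart_def)
  have polar: "X t = sqrt h * cos (\<theta> t)" "Y t = sqrt h * sin (\<theta> t)" if "t \<in> {0..1}" for t
  proof -
    have e: "exp (Re (q t)) = sqrt h" using norm_p[OF that] q(3)[OF that] by simp
    have "Re (p t) = X t" "Im (p t) = Y t" by (auto simp: p_def)
    then show "X t = sqrt h * cos (\<theta> t)" "Y t = sqrt h * sin (\<theta> t)"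
      using q(3)[OF that] e by (auto simp: Re_exp Im_exp \<theta>_def)
  qed
  have W_w: "oval_weight h (\<theta> t) = W t" if "t \<in> {0..1}" for t
  proof -
    have "1 - h * (cos (\<theta> t))\<^sup>2 = (W t)\<^sup>2"
      using X2[OF that] polar(1)[OF that] h by (simp add: power_mult_distrib)
    then show ?thesis using Wpos[OF that] by (simp add: oval_weight_def)
  qed
  obtain S D where S: "finite S" and D: "\<And>t. t \<in> {0..1} - S \<Longrightarrow> (g has_vector_derivative D t) (at t)"
    using path(1) unfolding valid_path_def piecewise_C1_differentiable_on_def C1_differentiable_on_def by blast
  define G where "G t = f (x t) * (y t) ^ 3 * Re (vector_derivative g (at t within {0..1}))" for t
  define Q where "Q t = - sqrt 2 * h\<^sup>2 * (\<Phi> (\<theta> t) + sqrt h * R (sin (\<theta> t)))" for t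
  \<comment> \<open>\<open>Q\<close> is a primitive of the line integrand along the path, except at the corners in \<open>S\<close>\<close>
  have derQ: "(Q has_vector_derivative G t) (at t)" if t: "t \<in> {0<..<1} - S" for t
  proof -
    have t01: "t \<in> {0..1}" using t by auto
    have Dt: "(g has_vector_derivative D t) (at t)" using D t by auto
    define x' where "x' = Re (D t)"
    have G_eq: "G t = f (x t) * (y t) ^ 3 * x'"
      unfolding G_def x'_def using vector_derivative_at_within_ivl[OF Dt, of 0 1] t by auto
    have dx: "(x has_real_derivative x') (at t)" and dy: "(y has_real_derivative Im (D t)) (at t)"
      unfolding x_def[abs_def] y_def[abs_def] x'_def has_real_derivative_iff_has_vector_derivative
      by (intro bounded_linear.has_vector_derivative[OF bounded_linear_Re Dt]
          bounded_linear.has_vector_derivative[OF bounded_linear_Im Dt])+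
    define r where "r = sqrt (1 + W t)"
    have r: "r > 0" "r\<^sup>2 = 1 + W t" "sqrt (2 - (x t)\<^sup>2) = r"
      using Wpos[OF t01] by (auto simp: r_def s2)
    have dX: "(X has_real_derivative x' * (2 * W t / r)) (at t)"
    proof -
      have "(X has_real_derivative x' * r + x t * ((- (2 * x t * x')) / (2 * r))) (at t)"
        unfolding X_def[abs_def] using xsq[OF t01] r
        by (auto intro!: derivative_eq_intros dx simp: divide_simps)
      also have "x' * r + x t * ((- (2 * x t * x')) / (2 * r)) = x' * (r\<^sup>2 - (x t)\<^sup>2) / r"
        using r(1) by (simp add: field_simps power2_eq_square)
      also have "r\<^sup>2 - (x t)\<^sup>2 = 2 * W t" by (simp add: r(2) W_def)
      finally show ?thesis by simp
    qed
    have "\<exists>Y'. (Y has_real_derivative Y') (at t)"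
      unfolding Y_def[abs_def] by (intro exI) (auto intro!: derivative_eq_intros dx dy)
    then obtain Y' where dY: "(Y has_real_derivative Y') (at t)" by blast
    have dp: "(p has_vector_derivative (of_real (x' * (2 * W t / r)) + \<i> * of_real Y')) (at t)"
      unfolding p_def[abs_def]
      by (intro has_vector_derivative_add has_vector_derivative_mult_right
            bounded_linear.has_vector_derivative[OF bounded_linear_of_real])
         (use dX dY in \<open>auto simp: has_real_derivative_iff_has_vector_derivative\<close>)
    define p' where "p' = of_real (x' * (2 * W t / r)) + \<i> * of_real Y'"
    have "isCont q t"
      using contq t by (intro continuous_on_interior) auto
    then have "(q has_vector_derivative p' / p t) (at t)"
      by (rule continuous_log_has_vector_derivative[where S = "{0<..<1}"]) (use q(3) t dp in \<open>auto simp: p'_def\<close>)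
    then have "\<exists>\<theta>'. (\<theta> has_vector_derivative \<theta>') (at t)"
      unfolding \<theta>_def[abs_def] by (blast intro: bounded_linear.has_vector_derivative[OF bounded_linear_Im])
    then obtain \<theta>' where d\<theta>: "(\<theta> has_real_derivative \<theta>') (at t)"
      by (auto simp: has_real_derivative_iff_has_vector_derivative)
    have "((\<lambda>t. sqrt h * cos (\<theta> t)) has_real_derivative sqrt h * (- sin (\<theta> t) * \<theta>')) (at t)"
      by (intro DERIV_cmult DERIV_chain2[OF DERIV_cos d\<theta>])
    then have "(X has_real_derivative sqrt h * (- sin (\<theta> t) * \<theta>')) (at t)"
      using t by (elim has_field_derivative_transform_within_open[where S = "{0<..<1}"]) (auto simp: polar(1))
    from DERIV_unique[OF dX this]
    have x': "x' = - sqrt h * sin (\<theta> t) * \<theta>' * r / (2 * W t)"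
      using r(1) Wpos[OF t01] by (simp add: field_simps)
    have y1: "(1 + x t) * y t = sqrt 2 * sqrt h * sin (\<theta> t)"
      using polar(2)[OF t01] by (simp add: Y_def field_simps)
    have x1: "x t = sqrt h * cos (\<theta> t) / r"
      using polar(1)[OF t01] r by (simp add: X_def field_simps)
    have "(Q has_real_derivative - sqrt 2 * h\<^sup>2 * (E (\<theta> t) * \<theta>' + sqrt h * (N (sin (\<theta> t)) * (cos (\<theta> t) * \<theta>')))) (at t)"
      unfolding Q_def[abs_def]
      by (intro DERIV_cmult DERIV_add DERIV_chain2[OF \<Phi> d\<theta>] DERIV_chain2[OF R] DERIV_chain2[OF DERIV_sin d\<theta>])
    also have "- sqrt 2 * h\<^sup>2 * (E (\<theta> t) * \<theta>' + sqrt h * (N (sin (\<theta> t)) * (cos (\<theta> t) * \<theta>'))) = G t"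
    proof -
      have regroup: "(a * b * s) ^ 3 * F * (- b * s * u * m / (2 * n)) = - (a ^ 3 / 2) * b ^ 4 * s ^ 4 * u / n * (F * m)"
        for a b s F u m n :: real by (simp add: power3_eq_cube power4_eq_xxxx)
      have v: "v (sin (\<theta> t)) = W t" using W_w[OF t01] by (simp add: w_v)
      have E: "E (\<theta> t) = r / W t * e (W t) * (sin (\<theta> t)) ^ 4"
        by (simp add: E_def W_w[OF t01] r_def)
      have N: "N (sin (\<theta> t)) = d (W t) / W t * (sin (\<theta> t)) ^ 4"
        by (simp add: N_def v)
      have "G t = ((1 + x t) * y t) ^ 3 * (e (W t) + x t * d (W t)) * x'"
        using f[of "x t"] gH[OF t01] by (simp add: G_eq W_def power_mult_distrib)
      also have "\<dots> = (sqrt 2 * sqrt h * sin (\<theta> t)) ^ 3 * (e (W t) + sqrt h * cos (\<theta> t) / r * d (W t))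
          * (- sqrt h * sin (\<theta> t) * \<theta>' * r / (2 * W t))"
        by (simp only: y1 x1[symmetric] x'[symmetric])
      also have "\<dots> = - ((sqrt 2) ^ 3 / 2) * (sqrt h) ^ 4 * (sin (\<theta> t)) ^ 4 * \<theta>' / W t
          * ((e (W t) + sqrt h * cos (\<theta> t) / r * d (W t)) * r)"
        by (rule regroup)
      also have "(e (W t) + sqrt h * cos (\<theta> t) / r * d (W t)) * r = e (W t) * r + sqrt h * cos (\<theta> t) * d (W t)"
        using r(1) by (simp add: field_simps)
      also have "(sqrt 2) ^ 3 / 2 = sqrt 2" by (simp add: power3_eq_cube)
      also have "(sqrt h) ^ 4 = h\<^sup>2" using h by (simp add: power4_eq_xxxx power2_eq_square)
      finally show ?thesis unfolding E N by (simp add: algebra_simps add_divide_distrib)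
    qed
    finally show ?thesis by (simp add: has_real_derivative_iff_has_vector_derivative)
  qed
  have "continuous_on {0..1} Q"
  proof -
    have "continuous_on UNIV \<Phi>" "continuous_on UNIV R"
      using \<Phi> R by (meson DERIV_continuous_on has_field_derivative_at_within)+
    then have "continuous_on {0..1} (\<lambda>t. \<Phi> (\<theta> t))" "continuous_on {0..1} (\<lambda>t. R (sin (\<theta> t)))"
      using continuous_on_compose2[OF _ cont\<theta> subset_UNIV]
        continuous_on_compose2[OF _ continuous_on_sin[OF cont\<theta>] subset_UNIV] by blast+
    then show ?thesis unfolding Q_def by (intro continuous_on_mult_left continuous_on_add)
  qed
  then have "(G has_integral Q 1 - Q 0) {0..1}"
    by (intro fundamental_theorem_of_calculus_interior_strong[OF S] derQ) auto
  then have "line_integral_dx g (\<lambda>x y. f x * y ^ 3) = Q 1 - Q 0"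
    unfolding line_integral_dx_def G_def x_def y_def by (simp add: integral_unique)
  also have "\<dots> = - \<sigma> * sqrt 2 * h\<^sup>2 * integral {0..2*pi} E"
  proof -
    have per: "E (u + 2 * pi) = E u" for u by (simp add: E_def oval_weight_def)
    have "\<Phi> (\<theta> 1) - \<Phi> (\<theta> 0) = \<sigma> * integral {0..2*pi} E"
      using \<sigma>(2) periodic_primitive[OF \<Phi> per, of "\<theta> 0"] periodic_primitive[OF \<Phi> per, of "\<theta> 0 - 2*pi"]
      by (auto simp: turn)
    moreover have "sin (\<theta> 1) = sin (\<theta> 0)"
      using \<sigma>(2) sin_periodic[of "\<theta> 0"] sin_periodic[of "\<theta> 0 - 2*pi"] by (auto simp: turn)
    ultimately show ?thesis by (simp add: Q_def algebra_simps)
  qed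
  finally show ?thesis unfolding E_def \<sigma>_def .
qed

section \<open>The three integrands\<close>

text \<open>
  \<open>even_part j w / w\<^sup>4\<close> at \<open>w = 1 - x\<^sup>2\<close> is the part even in \<open>x\<close> of \<open>f(x) / (1 + x)\<^sup>3\<close>, where \<open>f\<close> is
  \<open>f\<^sub>1\<close>, \<open>f\<^sub>2\<close>, \<open>f\<^sub>0\<close> for \<open>j = 0, 1, 2\<close>.  The type is left open because \<open>w\<close> is both a real and a complex variable
  below.
\<close>
definition even_part :: "nat \<Rightarrow> 'a::field_char_0 \<Rightarrow> 'a" where
  "even_part j w = (if j = 0 then 7 * w ^ 4 - w ^ 3 + 2 * w\<^sup>2
     else if j = 1 then 5 * w ^ 3 - w\<^sup>2 + 4 * w
     else 6 - 3 * w + 7 / 2 * w\<^sup>2 - 5 / 2 * w ^ 3)"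

lemma even_part_simps:
  "even_part 0 w = 7 * w ^ 4 - w ^ 3 + 2 * w\<^sup>2"
  "even_part 1 w = 5 * w ^ 3 - w\<^sup>2 + 4 * w"
  "even_part (Suc 0) w = 5 * w ^ 3 - w\<^sup>2 + 4 * w"
  "even_part 2 w = 6 - 3 * w + 7 / 2 * w\<^sup>2 - 5 / 2 * w ^ 3"
  by (simp_all add: even_part_def)

lemma f1_split:
  assumes "-1 < x" "x < 1"
  shows "f\<^sub>1 x = (1 + x) ^ 3 * (even_part 0 (1 - x\<^sup>2) / (1 - x\<^sup>2) ^ 4 + x * 0)"
proof -
  have nz: "x - 1 \<noteq> 0" "1 + x \<noteq> 0" using assms by auto
  have w: "1 - x\<^sup>2 = - (x - 1) * (1 + x)" by algebra
  show ?thesis unfolding f\<^sub>1_def w even_part_simps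
    using nz by (simp add: divide_simps) algebra
qed

lemma f2_split:
  assumes "-1 < x" "x < 1"
  shows "f\<^sub>2 x = (1 + x) ^ 3 * (even_part 1 (1 - x\<^sup>2) / (1 - x\<^sup>2) ^ 4
     + x * (- (6 * (1 - x\<^sup>2)\<^sup>2 + 4) / (1 - x\<^sup>2) ^ 3))"
proof -
  have nz: "x - 1 \<noteq> 0" "1 + x \<noteq> 0" using assms by auto
  have w: "1 - x\<^sup>2 = - (x - 1) * (1 + x)" by algebra
  show ?thesis unfolding f\<^sub>2_def w even_part_simps
    using nz by (simp add: divide_simps) algebra
qed

lemma f0_split:
  assumes "-1 < x" "x < 1"
  shows "f\<^sub>0 x = (1 + x) ^ 3 * (even_part 2 (1 - x\<^sup>2) / (1 - x\<^sup>2) ^ 4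
     + x * ((6 + 4 * (1 - x\<^sup>2)\<^sup>2) / (1 - x\<^sup>2) ^ 4))"
proof -
  have nz: "x - 1 \<noteq> 0" "1 + x \<noteq> 0" using assms by auto
  have w: "1 - x\<^sup>2 = - (x - 1) * (1 + x)" by algebra
  show ?thesis unfolding f\<^sub>0_def w even_part_simps
    using nz by (simp add: divide_simps) algebra
qed

lemma linear_system_2:
  fixes \<alpha> \<beta> :: real
  assumes "\<alpha> * a0 + \<beta> * a1 = 0" "\<alpha> * b0 + \<beta> * b1 = 0" "a0 * b1 - b0 * a1 \<noteq> 0"
  shows "\<alpha> = 0" "\<beta> = 0"
proof -
  have "\<alpha> * (a0 * b1 - b0 * a1) = 0" "\<beta> * (a0 * b1 - b0 * a1) = 0"
    using assms(1,2) by algebra+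
  then show "\<alpha> = 0" "\<beta> = 0" using assms(3) by auto
qed

lemma linear_system_3:
  fixes \<alpha> \<beta> \<gamma> :: real
  assumes "\<alpha> * a0 + \<beta> * a1 + \<gamma> * a2 = 0" "\<alpha> * b0 + \<beta> * b1 + \<gamma> * b2 = 0"
    "\<alpha> * c0 + \<beta> * c1 + \<gamma> * c2 = 0"
    "a0 * (b1 * c2 - b2 * c1) - a1 * (b0 * c2 - b2 * c0) + a2 * (b0 * c1 - b1 * c0) \<noteq> 0" (is "?d \<noteq> 0")
  shows "\<alpha> = 0" "\<beta> = 0" "\<gamma> = 0"
proof -
  have "\<alpha> * ?d = 0" "\<beta> * ?d = 0" "\<gamma> * ?d = 0"
    using assms(1,2,3) by algebra+
  then show "\<alpha> = 0" "\<beta> = 0" "\<gamma> = 0" using assms(4) by auto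
qed

text \<open>
  The determinant is \<open>a b (a - b)\<close> times a polynomial in \<open>S = a + b\<close> and \<open>p = a b\<close>.  That factor is positive:
  by \<open>4 p \<le> S\<^sup>2\<close> its quadratic terms leave room for the squares \<open>(S - 2)\<^sup>2\<close> and \<open>(p - S)\<^sup>2\<close>.
\<close>
lemma even_part_det_2:
  fixes a b :: real
  assumes "0 < a" "0 < b" "a \<noteq> b"
  shows "even_part 0 a * even_part 1 b - even_part 0 b * even_part 1 a \<noteq> 0"
proof -
  define S p where "S = a + b" and "p = a * b"
  have "even_part 0 a * even_part 1 b - even_part 0 b * even_part 1 a
      = p * (a - b) * (8 - 4 * S + 28 * S\<^sup>2 - 37 * p - 7 * p * S + 35 * p\<^sup>2)"
    unfolding even_part_simps S_def p_def by algebra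
  moreover have "8 - 4 * S + 28 * S\<^sup>2 - 37 * p - 7 * p * S + 35 * p\<^sup>2 > 0"
  proof -
    have "S\<^sup>2 - 4 * p = (a - b)\<^sup>2" unfolding S_def p_def by algebra
    then have "4 * p \<le> S\<^sup>2" by (smt (verit) zero_le_power2)
    moreover have "(S - 2)\<^sup>2 \<ge> 0" "(p - S)\<^sup>2 \<ge> 0" "S\<^sup>2 \<ge> 0" "p\<^sup>2 \<ge> 0" by auto
    moreover have "(S - 2)\<^sup>2 = S\<^sup>2 - 4 * S + 4" "(p - S)\<^sup>2 = p\<^sup>2 - 2 * (p * S) + S\<^sup>2" by algebra+
    ultimately show ?thesis unfolding mult.assoc by linarith
  qed
  moreover have "p * (a - b) \<noteq> 0" using assms by (auto simp: p_def)
  ultimately show ?thesis by auto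
qed

text \<open>
  The determinant is the Vandermonde determinant times a symmetric polynomial \<open>P\<close>, whose coefficients come from
  the Cauchy-Binet expansion into maximal minors of the coefficient matrix times Schur polynomials, rewritten in
  the elementary symmetric functions \<open>e1\<close>, \<open>e2\<close>, \<open>e3\<close> of \<open>a\<close>, \<open>b\<close>, \<open>c\<close>.  \<open>P\<close> is positive because \<open>3 e2 \<le> e1\<^sup>2\<close> and \<open>3 e1 e3 \<le> e2\<^sup>2\<close> (Newton's inequalities) absorb the large negative terms.
\<close>
lemma even_part_det_3:
  fixes a b c :: real
  assumes "0 < a" "0 < b" "0 < c" "a \<noteq> b" "b \<noteq> c" "a \<noteq> c"
  shows "even_part 0 a * (even_part 1 b * even_part 2 c - even_part 2 b * even_part 1 c)
       - even_part 1 a * (even_part 0 b * even_part 2 c - even_part 2 b * even_part 0 c)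
       + even_part 2 a * (even_part 0 b * even_part 1 c - even_part 1 b * even_part 0 c) \<noteq> 0" (is "?det \<noteq> 0")
proof -
  define e1 e2 e3 where "e1 = a + b + c" and "e2 = a * b + b * c + c * a" and "e3 = a * b * c"
  define P where "P = 48 - 24 * e1 + 168 * e1\<^sup>2 - 222 * e2 - 42 * e1 * e2 + 63 * e3 + 210 * e2\<^sup>2
      - 287 * e1 * e3 - 35 * e2 * e3 + 105 * e3\<^sup>2"
  have "2 * ?det = 2 * ((a - b) * (b - c) * (a - c) * P)"
    unfolding even_part_simps P_def e1_def e2_def e3_def by algebra
  then have det: "?det = (a - b) * (b - c) * (a - c) * P" by simp
  have "e3 > 0" using assms by (simp add: e3_def)
  have "2 * (e1\<^sup>2 - 3 * e2) = (a - b)\<^sup>2 + (b - c)\<^sup>2 + (c - a)\<^sup>2"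
    unfolding e1_def e2_def by algebra
  then have 1: "3 * e2 \<le> e1\<^sup>2" by (smt (verit) zero_le_power2)
  have "2 * (e2\<^sup>2 - 3 * (e1 * e3)) = (a * b - b * c)\<^sup>2 + (b * c - c * a)\<^sup>2 + (c * a - a * b)\<^sup>2"
    unfolding e1_def e2_def e3_def by algebra
  then have 2: "3 * (e1 * e3) \<le> e2\<^sup>2" by (smt (verit) zero_le_power2)
  have "(e1 - 1)\<^sup>2 = e1\<^sup>2 - 2 * e1 + 1" "(e1 - e2)\<^sup>2 = e1\<^sup>2 - 2 * (e1 * e2) + e2\<^sup>2"
    "(e2 - e3)\<^sup>2 = e2\<^sup>2 - 2 * (e2 * e3) + e3\<^sup>2" by algebra+
  moreover have "(e1 - 1)\<^sup>2 \<ge> 0" "(e1 - e2)\<^sup>2 \<ge> 0" "(e2 - e3)\<^sup>2 \<ge> 0" "e1\<^sup>2 \<ge> 0" "e2\<^sup>2 \<ge> 0" "e3\<^sup>2 \<ge> 0" by auto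
  ultimately have "P > 0" using 1 2 \<open>e3 > 0\<close> unfolding P_def mult.assoc by linarith
  then show ?thesis unfolding det using assms by auto
qed

lemma even_part_few_zeros:
  fixes \<alpha> :: "nat \<Rightarrow> real"
  assumes "k \<le> 3" "\<exists>j<k. \<alpha> j \<noteq> 0"
  shows "finite {w. 0 < w \<and> (\<Sum>j<k. \<alpha> j * even_part j w) = 0} \<and>
     card {w. 0 < w \<and> (\<Sum>j<k. \<alpha> j * even_part j w) = 0} < k" (is "finite ?Z \<and> _")
proof (rule ccontr)
  assume "\<not> ?thesis"
  then have "\<exists>A \<subseteq> ?Z. finite A \<and> card A = k"
    by (metis (no_types, lifting) infinite_arbitrarily_large not_less obtain_subset_with_card_n)
  then obtain A where A: "A \<subseteq> ?Z" "card A = k" by blast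
  have k: "k = 1 \<or> k = 2 \<or> k = 3" using assms by auto
  have "\<alpha> j = 0" if "j < k" for j
    using k
  proof (elim disjE)
    assume k1: "k = 1"
    then obtain a where "A = {a}" using A by (auto simp: card_Suc_eq)
    then have a: "a > 0" "\<alpha> 0 * even_part 0 a = 0" using A(1) k1 by auto
    have "even_part 0 a = a\<^sup>2 * (6 * a\<^sup>2 + (a - 1/2)\<^sup>2 + 7/4)" unfolding even_part_simps by algebra
    also have "\<dots> > 0" using a by (intro mult_pos_pos) (auto intro!: add_nonneg_pos)
    finally have "\<alpha> 0 = 0" using a(2) by simp
    then show ?thesis using that k1 by simp
  next
    assume k2: "k = 2"
    then obtain a b where ab: "A = {a, b}" "a \<noteq> b" using A(2) by (auto simp: card_2_iff)
    have eq: "0 < w \<and> \<alpha> 0 * even_part 0 w + \<alpha> 1 * even_part 1 w = 0" if "w \<in> A" for w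
      using A(1) that k2 by (auto simp: numeral_2_eq_2)
    have "a \<in> A" "b \<in> A" using ab by auto
    note eqs = eq[OF this(1)] eq[OF this(2)]
    note det = even_part_det_2[OF eqs[THEN conjunct1] ab(2)]
    note \<alpha>0 = linear_system_2[OF eqs[THEN conjunct2] det]
    have "j = 0 \<or> j = 1" using that k2 by auto
    then show ?thesis using \<alpha>0 by blast
  next
    assume k3: "k = 3"
    then obtain a b c where abc: "A = {a, b, c}" "a \<noteq> b" "b \<noteq> c" "a \<noteq> c"
      using A(2) by (auto simp: card_3_iff)
    have eq: "0 < w \<and> \<alpha> 0 * even_part 0 w + \<alpha> 1 * even_part 1 w + \<alpha> 2 * even_part 2 w = 0" if "w \<in> A" for w
      using A(1) that k3 by (auto simp: eval_nat_numeral)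
    have "a \<in> A" "b \<in> A" "c \<in> A" using abc by auto
    note eqs = eq[OF this(1)] eq[OF this(2)] eq[OF this(3)]
    note det = even_part_det_3[OF eqs[THEN conjunct1] abc(2-4)]
    note \<alpha>0 = linear_system_3[OF eqs[THEN conjunct2] det]
    have "j = 0 \<or> j = 1 \<or> j = 2" using that k3 by auto
    then show ?thesis using \<alpha>0 by blast
  qed
  then show False using assms(2) by blast
qed

lemma circle_moment_holomorphic:
  assumes "K holomorphic_on ball 0 1"
  shows "circle_moment K (Suc j) holomorphic_on ball 0 1"
  unfolding holomorphic_on_open[OF open_ball] using circle_moment_has_derivative[OF assms] by blast

lemma circle_moment_higher_deriv:
  assumes K: "K holomorphic_on ball 0 1" and "i \<le> m"
  shows "\<exists>C. C \<noteq> 0 \<and> (\<forall>z\<in>ball 0 1. (deriv ^^ i) (circle_moment K m) z = C * circle_moment K (m - i) z)"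
  using \<open>i \<le> m\<close>
proof (induction i)
  case 0 then show ?case by (intro exI[of _ 1]) auto
next
  case (Suc i)
  then obtain C where C: "C \<noteq> 0"
      "\<And>z. z \<in> ball 0 1 \<Longrightarrow> (deriv ^^ i) (circle_moment K m) z = C * circle_moment K (m - i) z" by auto
  define n where "n = m - Suc i"
  have n: "m - i = Suc n" using Suc.prems by (simp add: n_def)
  define c where "c = (2 * of_nat n + 1) / (2::complex)"
  have "of_nat (2 * n + 1) \<noteq> (0::complex)" by (simp only: of_nat_eq_0_iff)
  then have "c \<noteq> 0" by (simp add: c_def add.commute)
  have "(deriv ^^ Suc i) (circle_moment K m) z = C * c * circle_moment K n z" if z: "z \<in> ball 0 1" for z
  proof -
    have "eventually (\<lambda>w. (deriv ^^ i) (circle_moment K m) w = C * circle_moment K (Suc n) w) (nhds z)"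
      unfolding eventually_nhds using C(2) z n by (intro exI[of _ "ball 0 1"]) simp
    then have "(deriv ^^ Suc i) (circle_moment K m) z = deriv (\<lambda>w. C * circle_moment K (Suc n) w) z"
      by (simp add: deriv_cong_ev)
    also have "\<dots> = C * (c * circle_moment K n z)"
      unfolding c_def by (intro DERIV_imp_deriv DERIV_cmult circle_moment_has_derivative K z)
    finally show ?thesis by simp
  qed
  then show ?case using C(1) \<open>c \<noteq> 0\<close> by (intro exI[of _ "C * c"]) (auto simp: n_def)
qed

lemma circle_moment_sum:
  fixes k :: nat
  assumes K: "\<And>j. j < k \<Longrightarrow> continuous_on (ball 0 1) (K j)" and z: "z \<in> ball 0 1"
  shows "circle_moment (\<lambda>z. \<Sum>j<k. c j * K j z) m z = (\<Sum>j<k. c j * circle_moment (K j) m z)"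
proof -
  have in_ball: "z * of_real ((cos \<theta>)\<^sup>2) \<in> ball 0 1" for \<theta>
  proof -
    have "norm (z * of_real ((cos \<theta>)\<^sup>2)) \<le> norm z * 1"
      unfolding norm_mult by (intro mult_left_mono) (auto simp: abs_square_le_1 norm_power)
    also have "\<dots> < 1" using z by simp
    finally show ?thesis unfolding mem_ball_0 .
  qed
  define I where "I j \<theta> = K j (z * of_real ((cos \<theta>)\<^sup>2)) * of_real (((sin \<theta>)\<^sup>2) ^ m)" for j \<theta>
  have int: "I j integrable_on {0..2*pi}" if "j < k" for j
  proof -
    have "continuous_on {0..2*pi} (\<lambda>\<theta>. K j (z * of_real ((cos \<theta>)\<^sup>2)))"
      by (rule continuous_on_compose2[OF K[OF that]]) (use in_ball in \<open>auto simp del: mem_ball_0 mem_ball intro!: continuous_intros\<close>)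
    then show ?thesis unfolding I_def
      by (intro integrable_continuous_interval continuous_on_mult) (auto intro!: continuous_intros)
  qed
  have "integral {0..2*pi} (\<lambda>\<theta>. (\<Sum>j<k. c j * K j (z * of_real ((cos \<theta>)\<^sup>2))) * of_real (((sin \<theta>)\<^sup>2) ^ m))
      = integral {0..2*pi} (\<lambda>\<theta>. \<Sum>j<k. c j * I j \<theta>)"
    by (simp add: I_def sum_distrib_right mult.assoc)
  also have "\<dots> = (\<Sum>j<k. integral {0..2*pi} (\<lambda>\<theta>. c j * I j \<theta>))"
    by (intro integral_sum integrable_on_mult_right int finite_lessThan) auto
  also have "\<dots> = (\<Sum>j<k. c j * integral {0..2*pi} (I j))"
    by simp
  finally show ?thesis
    unfolding circle_moment_def I_def by (simp add: sum_distrib_left mult.left_commute)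
qed

lemma circle_moment_of_real:
  assumes "0 \<le> x" "\<And>u. 0 \<le> u \<Longrightarrow> u \<le> x \<Longrightarrow> K (of_real u) = of_real (k u)" "continuous_on {0..x} k"
  shows "circle_moment K j (of_real x) =
    of_real (x ^ j * integral {0..2*pi} (\<lambda>\<theta>. k (x * (cos \<theta>)\<^sup>2) * ((sin \<theta>)\<^sup>2) ^ j))"
proof -
  define I where "I \<theta> = k (x * (cos \<theta>)\<^sup>2) * ((sin \<theta>)\<^sup>2) ^ j" for \<theta>
  have rng: "0 \<le> x * (cos \<theta>)\<^sup>2 \<and> x * (cos \<theta>)\<^sup>2 \<le> x" for \<theta>
    using assms(1) by (simp add: mult_left_le abs_square_le_1)
  have "continuous_on {0..2*pi} (\<lambda>\<theta>. k (x * (cos \<theta>)\<^sup>2))"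
    by (rule continuous_on_compose2[OF assms(3)]) (use rng in \<open>auto intro!: continuous_intros\<close>)
  then have "I integrable_on {0..2*pi}"
    unfolding I_def by (intro integrable_continuous_interval continuous_on_mult) (auto intro!: continuous_intros)
  then have "integral {0..2*pi} (of_real \<circ> I) = complex_of_real (integral {0..2*pi} I)"
    by (rule integral_linear[OF _ bounded_linear_of_real])
  moreover have "K (of_real x * (of_real (cos \<theta>))\<^sup>2) = of_real (k (x * (cos \<theta>)\<^sup>2))" for \<theta>
    using assms(2)[of "x * (cos \<theta>)\<^sup>2"] rng[of \<theta>] by simp
  then have "(of_real \<circ> I) = (\<lambda>\<theta>. K (of_real x * of_real ((cos \<theta>)\<^sup>2)) * of_real (((sin \<theta>)\<^sup>2) ^ j))"
    by (simp add: fun_eq_iff I_def)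
  ultimately show ?thesis
    by (simp add: circle_moment_def I_def[abs_def])
qed

section \<open>The integrals as circle moments\<close>

definition kernel :: "nat \<Rightarrow> complex \<Rightarrow> complex" where
  "kernel j z = (let w = csqrt (1 - z) in csqrt (1 + w) / w * (even_part j w / w ^ 4))"

definition real_kernel :: "nat \<Rightarrow> real \<Rightarrow> real" where
  "real_kernel j u = (let w = sqrt (1 - u) in sqrt (1 + w) / w * (even_part j w / w ^ 4))"

lemma even_part_holomorphic [holomorphic_intros]:
  assumes "f holomorphic_on A"
  shows "(\<lambda>z. even_part j (f z)) holomorphic_on A"
  using assms unfolding even_part_def
  by (cases "j = 0"; cases "j = 1"; simp; intro holomorphic_intros; simp)

lemma even_part_continuous [continuous_intros]:
  fixes f :: "real \<Rightarrow> real"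
  assumes "continuous_on A f"
  shows "continuous_on A (\<lambda>x. even_part j (f x))"
  using assms unfolding even_part_def
  by (cases "j = 0"; cases "j = 1"; simp; intro continuous_intros; simp)

lemma kernel_holomorphic: "kernel j holomorphic_on ball 0 1"
proof -
  have 1: "1 - z \<notin> \<real>\<^sub>\<le>\<^sub>0" if "z \<in> ball 0 1" for z :: complex
    using that complex_Re_le_cmod[of z] by (auto simp: complex_nonpos_Reals_iff)
  have 2: "1 + csqrt (1 - z) \<notin> \<real>\<^sub>\<le>\<^sub>0" for z
    using csqrt_principal[of "1 - z"] by (auto simp: complex_nonpos_Reals_iff simp del: csqrt.simps)
  have 3: "csqrt (1 - z) \<noteq> 0" if "z \<in> ball 0 1" for z
    using 1[OF that] by auto
  show ?thesis unfolding kernel_def[abs_def] Let_def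
    by (intro holomorphic_intros) (use 1 2 3 in \<open>auto simp del: csqrt.simps csqrt_eq_0\<close>)
qed

lemma kernel_of_real: "kernel j (of_real u) = of_real (real_kernel j u)" if "u < 1"
proof -
  have "csqrt (1 - of_real u) = of_real (sqrt (1 - u))"
    using that csqrt_of_real_nonneg[of "1 - of_real u"] by simp
  moreover have "csqrt (1 + of_real (sqrt (1 - u))) = of_real (sqrt (1 + sqrt (1 - u)))"
    using that csqrt_of_real_nonneg[of "1 + of_real (sqrt (1 - u))"] by simp
  ultimately show ?thesis
    by (simp add: kernel_def real_kernel_def Let_def even_part_def)
qed

lemma real_kernel_continuous: "continuous_on {..<1} (real_kernel j)"
  unfolding real_kernel_def[abs_def] Let_def
  by (intro continuous_intros) (auto simp: add_pos_pos)

text \<open>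
  The derivatives of order \<open>i < k\<close> at \<open>x\<close> are nonzero multiples of the moments with exponent \<open>2 - i\<close>, which
  are the \<open>k\<close> consecutive exponents from \<open>3 - k\<close> to \<open>2\<close>.
\<close>
lemma kernel_combination_vanishing:
  fixes \<alpha> :: "nat \<Rightarrow> real"
  assumes "k \<le> 3" and x: "0 < x" "x < 1"
    and van: "vanishes_to k (circle_moment (\<lambda>z. \<Sum>j<k. of_real (\<alpha> j) * kernel j z) 2) (of_real x)"
  shows "\<forall>j<k. \<alpha> j = 0"
proof (rule ccontr)
  assume "\<not> (\<forall>j<k. \<alpha> j = 0)"
  then have \<alpha>: "\<exists>j<k. \<alpha> j \<noteq> 0" by blast
  define K where "K z = (\<Sum>j<k. of_real (\<alpha> j) * kernel j z)" for z
  define \<kappa> where "\<kappa> u = (\<Sum>j<k. \<alpha> j * real_kernel j u)" for u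
  have holK: "K holomorphic_on ball 0 1" unfolding K_def by (intro holomorphic_intros kernel_holomorphic)
  have K\<kappa>: "K (of_real u) = of_real (\<kappa> u)" if "u < 1" for u
    by (simp add: K_def \<kappa>_def kernel_of_real that)
  have cont\<kappa>: "continuous_on {..<1} \<kappa>"
    unfolding \<kappa>_def by (intro continuous_intros real_kernel_continuous)
  have moment0: "integral {0..2*pi} (\<lambda>\<theta>. \<kappa> (x * (cos \<theta>)\<^sup>2) * ((sin \<theta>)\<^sup>2) ^ (2 - i)) = 0" if "i < k" for i
  proof -
    have "(deriv ^^ i) (circle_moment K 2) (of_real x) = 0"
      using van that unfolding vanishes_to_def K_def[abs_def] by blast
    moreover have "i \<le> 2" using that \<open>k \<le> 3\<close> by simp
    moreover have "complex_of_real x \<in> ball 0 1" using x by simp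
    ultimately have "circle_moment K (2 - i) (of_real x) = 0"
      using circle_moment_higher_deriv[OF holK, of i 2] by auto
    also have "circle_moment K (2 - i) (of_real x) = of_real (x ^ (2 - i) *
        integral {0..2*pi} (\<lambda>\<theta>. \<kappa> (x * (cos \<theta>)\<^sup>2) * ((sin \<theta>)\<^sup>2) ^ (2 - i)))"
      using x by (intro circle_moment_of_real K\<kappa> continuous_on_subset[OF cont\<kappa>]) auto
    finally show ?thesis using x by simp
  qed
  define \<phi> where "\<phi> s = \<kappa> (x - x * s)" for s
  have \<phi>_sin: "\<phi> ((sin \<theta>)\<^sup>2) = \<kappa> (x * (cos \<theta>)\<^sup>2)" for \<theta>
    by (simp add: \<phi>_def cos_squared_eq algebra_simps)
  have small: "x - x * s < 1" if "0 \<le> s" for s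
    using x that mult_nonneg_nonneg[of x s] by linarith
  have cont\<phi>: "continuous_on {0..1} \<phi>"
    unfolding \<phi>_def by (rule continuous_on_compose2[OF cont\<kappa>]) (use small in \<open>auto intro!: continuous_intros\<close>)
  define P where "P w = (\<Sum>j<k. \<alpha> j * even_part j w)" for w
  define wt where "wt s = sqrt (1 - (x - x * s))" for s
  \<comment> \<open>\<open>wt\<close> maps the zeros of \<open>\<phi>\<close> injectively to positive zeros of \<open>P\<close>\<close>
  have P_zero: "P (wt s) = 0 \<and> 0 < wt s" if "s \<in> {0<..<1}" "\<phi> s = 0" for s
  proof -
    have "wt s > 0" using small[of s] that by (simp add: wt_def)
    moreover have "\<phi> s = sqrt (1 + wt s) / wt s / wt s ^ 4 * P (wt s)"
      unfolding \<phi>_def \<kappa>_def P_def real_kernel_def Let_def wt_def[symmetric] sum_distrib_left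
      by (intro sum.cong) (simp_all add: mult_ac)
    ultimately show ?thesis using that by (auto simp: add_pos_pos less_imp_neq[symmetric])
  qed
  have few: "finite {w. 0 < w \<and> P w = 0}" "card {w. 0 < w \<and> P w = 0} < k"
    using even_part_few_zeros[OF \<open>k \<le> 3\<close> \<alpha>] by (auto simp: P_def)
  have inj: "inj_on wt {s \<in> {0<..<1}. \<phi> s = 0}"
    using x by (intro inj_onI) (simp add: wt_def)
  have img: "wt ` {s \<in> {0<..<1}. \<phi> s = 0} \<subseteq> {w. 0 < w \<and> P w = 0}"
    using P_zero by blast
  have "finite {s \<in> {0<..<1}. \<phi> s = 0}"
    using finite_imageD[OF finite_subset[OF img few(1)] inj] .
  moreover have "card {s \<in> {0<..<1}. \<phi> s = 0} < k"
    using card_inj_on_le[OF inj img few(1)] few(2) by linarith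
  ultimately obtain i where i: "i < k"
      "integral {0..2*pi} (\<lambda>\<theta>. \<phi> ((sin \<theta>)\<^sup>2) * ((sin \<theta>)\<^sup>2) ^ (3 - k + i)) \<noteq> 0"
    using nonzero_moment[OF cont\<phi>] by blast
  have "3 - k + i = 2 - (k - 1 - i)" using i(1) \<open>k \<le> 3\<close> by simp
  then show False using i(2) moment0[of "k - 1 - i"] i(1) unfolding \<phi>_sin by auto
qed

lemma oval_integral_eq_circle_moment:
  assumes g: "parametrizes_oval g h" and h: "0 < h" "h < 1"
    and f: "\<And>x. -1 < x \<Longrightarrow> x < 1 \<Longrightarrow> f x = (1 + x) ^ 3 * (even_part j (1 - x\<^sup>2) / (1 - x\<^sup>2) ^ 4 + x * d (1 - x\<^sup>2))"
    and d: "continuous_on {0<..} d"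
  shows "of_real (line_integral_dx g (\<lambda>x y. f x * y ^ 3)) =
     of_real (- Re (winding_number g 0) * sqrt 2) * circle_moment (kernel j) 2 (of_real h)"
proof -
  have e: "continuous_on {0<..} (\<lambda>w::real. even_part j w / w ^ 4)"
    by (intro continuous_intros) auto
  have "circle_moment (kernel j) 2 (of_real h) =
      of_real (h\<^sup>2 * integral {0..2*pi} (\<lambda>\<theta>. real_kernel j (h * (cos \<theta>)\<^sup>2) * ((sin \<theta>)\<^sup>2)\<^sup>2))"
    using h by (intro circle_moment_of_real kernel_of_real continuous_on_subset[OF real_kernel_continuous]) auto
  also have "(\<lambda>\<theta>. real_kernel j (h * (cos \<theta>)\<^sup>2) * ((sin \<theta>)\<^sup>2)\<^sup>2) =
      (\<lambda>\<theta>. sqrt (1 + oval_weight h \<theta>) / oval_weight h \<theta> * (even_part j (oval_weight h \<theta>) / oval_weight h \<theta> ^ 4) * (sin \<theta>) ^ 4)"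
    by (simp add: real_kernel_def oval_weight_def Let_def fun_eq_iff)
  finally have "circle_moment (kernel j) 2 (of_real h) = of_real (h\<^sup>2 *
      integral {0..2*pi} (\<lambda>\<theta>. sqrt (1 + oval_weight h \<theta>) / oval_weight h \<theta> *
        (even_part j (oval_weight h \<theta>) / oval_weight h \<theta> ^ 4) * (sin \<theta>) ^ 4))" .
  moreover have "line_integral_dx g (\<lambda>x y. f x * y ^ 3) = - Re (winding_number g 0) * sqrt 2 * h\<^sup>2 *
      integral {0..2*pi} (\<lambda>\<theta>. sqrt (1 + oval_weight h \<theta>) / oval_weight h \<theta> *
        (even_part j (oval_weight h \<theta>) / oval_weight h \<theta> ^ 4) * (sin \<theta>) ^ 4)"
    by (rule oval_line_integral[where e = "\<lambda>w. even_part j w / w ^ 4" and d = d, OF g h f e d])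
  ultimately show ?thesis by (simp add: mult.assoc)
qed

theorem mainTheorem6:
  fixes \<gamma> :: "real \<Rightarrow> real \<Rightarrow> complex" and s :: complex
  assumes oval: "\<And>h. h \<in> {0<..<1} \<Longrightarrow> parametrizes_oval (\<gamma> h) h"
    and orientation: "\<And>h. h \<in> {0<..<1} \<Longrightarrow> winding_number (\<gamma> h) 0 = s"
  shows "ECT_set {# \<lambda>h. line_integral_dx (\<gamma> h) (\<lambda>x y. f\<^sub>0 x * y ^ 3),
                    \<lambda>h. line_integral_dx (\<gamma> h) (\<lambda>x y. f\<^sub>1 x * y ^ 3),
                    \<lambda>h. line_integral_dx (\<gamma> h) (\<lambda>x y. f\<^sub>2 x * y ^ 3) #} {0<..<1}"
proof -
  define fs where "fs = [\<lambda>h. line_integral_dx (\<gamma> h) (\<lambda>x y. f\<^sub>1 x * y ^ 3),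
                    \<lambda>h. line_integral_dx (\<gamma> h) (\<lambda>x y. f\<^sub>2 x * y ^ 3),
                    \<lambda>h. line_integral_dx (\<gamma> h) (\<lambda>x y. f\<^sub>0 x * y ^ 3)]"
  define c where "c = complex_of_real (- Re s * sqrt 2)"
  have "c \<noteq> 0"
  proof -
    have "parametrizes_oval (\<gamma> (1/2)) (1/2)" "winding_number (\<gamma> (1/2)) 0 = s"
      using oval orientation by auto
    then have "s = 1 \<or> s = -1"
      unfolding parametrizes_oval_def by (metis simple_closed_path_winding_number_inside)
    then show ?thesis by (auto simp: c_def)
  qed
  have ext: "of_real ((fs ! i) x) = c * circle_moment (kernel i) 2 (of_real x)"
    if i: "i < length fs" and x: "x \<in> {0<..<1}" for i x
  proof -
    have h: "0 < x" "x < 1" using x by auto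
    note * = oval_integral_eq_circle_moment[OF oval[OF x] h, unfolded orientation[OF x], folded c_def]
    have cont: "continuous_on {0<..} (\<lambda>w::real. 0::real)"
      "continuous_on {0<..} (\<lambda>w::real. - (6 * w\<^sup>2 + 4) / w ^ 3)"
      "continuous_on {0<..} (\<lambda>w::real. (6 + 4 * w\<^sup>2) / w ^ 4)"
      by (auto intro!: continuous_intros)
    consider "i = 0" | "i = 1" | "i = 2" using i by (fastforce simp: fs_def)
    then show ?thesis
    proof cases
      case 1 then show ?thesis using *[OF f1_split cont(1)] by (simp add: fs_def)
    next
      case 2 then show ?thesis using *[OF f2_split cont(2)] by (simp add: fs_def)
    next
      case 3 then show ?thesis using *[OF f0_split cont(3)] by (simp add: fs_def)
    qed
  qed
  have hol: "circle_moment K 2 holomorphic_on ball 0 1" if "K holomorphic_on ball 0 1" for K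
    using circle_moment_holomorphic[OF that, of 1] by (simp add: numeral_2_eq_2)
  have "ECT_system fs {0<..<1}"
  proof (rule ECT_systemI[where U = "ball 0 1" and F = "\<lambda>i z. c * circle_moment (kernel i) 2 z"])
    fix k \<alpha> x j
    assume k: "k \<le> length fs" and x: "x \<in> {0<..<1}" and j: "j < k"
      and van: "vanishes_to k (\<lambda>z. \<Sum>j<k. of_real (\<alpha> j) * (c * circle_moment (kernel j) 2 z)) (of_real x)"
    define K where "K z = (\<Sum>j<k. of_real (\<alpha> j) * kernel j z)" for z
    have xb: "complex_of_real x \<in> ball 0 1" using x by simp
    have holK: "K holomorphic_on ball 0 1" unfolding K_def by (intro holomorphic_intros kernel_holomorphic)
    have quotient: "vanishes_to k (\<lambda>z. (\<Sum>j<k. of_real (\<alpha> j) * (c * circle_moment (kernel j) 2 z)) * inverse c) (of_real x)"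
      by (rule vanishes_to_mult[OF _ _ open_ball xb van]) (auto intro!: holomorphic_intros hol kernel_holomorphic)
    have "(\<Sum>j<k. of_real (\<alpha> j) * (c * circle_moment (kernel j) 2 z)) * inverse c
        = circle_moment K 2 z" if "z \<in> ball 0 1" for z
    proof -
      have "(\<Sum>j<k. of_real (\<alpha> j) * (c * circle_moment (kernel j) 2 z)) * inverse c
          = (\<Sum>j<k. of_real (\<alpha> j) * circle_moment (kernel j) 2 z)"
        unfolding sum_distrib_right using \<open>c \<noteq> 0\<close> by (intro sum.cong) (auto simp: field_simps)
      also have "\<dots> = circle_moment K 2 z"
        unfolding K_def[abs_def] using that
        by (intro circle_moment_sum[symmetric] holomorphic_on_imp_continuous_on kernel_holomorphic)
      finally show ?thesis .
    qed
    then have ev: "eventually (\<lambda>z. (\<Sum>j<k. of_real (\<alpha> j) * (c * circle_moment (kernel j) 2 z)) * inverse c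
        = circle_moment K 2 z) (nhds (of_real x))"
      using xb unfolding eventually_nhds by (intro exI[of _ "ball 0 1"]) simp
    have "vanishes_to k (circle_moment K 2) (of_real x)"
      using quotient vanishes_to_cong[OF ev] by blast
    then have "\<forall>j<k. \<alpha> j = 0"
      using k x unfolding K_def[abs_def] by (intro kernel_combination_vanishing) (auto simp: fs_def)
    then show "\<alpha> j = 0" using j by blast
  qed (use ext in \<open>auto simp: is_interval_oo intro!: holomorphic_intros hol kernel_holomorphic\<close>)
  moreover have "mset fs = {# \<lambda>h. line_integral_dx (\<gamma> h) (\<lambda>x y. f\<^sub>0 x * y ^ 3),
                    \<lambda>h. line_integral_dx (\<gamma> h) (\<lambda>x y. f\<^sub>1 x * y ^ 3),
                    \<lambda>h. line_integral_dx (\<gamma> h) (\<lambda>x y. f\<^sub>2 x * y ^ 3) #}"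
    by (simp add: fs_def add_mset_commute)
  ultimately show ?thesis unfolding ECT_set_def by blast
qed

end
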